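(* Let $d\ge 3$ and $1\le h<d$ be integers, let $K_d$ be a complete metric graph on $d$ vertices (with arbitrary edge lengths), and let $K_d'=K_d\setminus K_h$ be the metric graph obtained from $K_d$ by omitting all the edges between $h$ chosen vertices. Then the gonality of $K_d'$ is $d-h$.
   Context: A metric graph $\Gamma$ is a compact connected topological space in which every point $p$ has a neighbourhood homeomorphic to a star with $\mathrm{val}(p)$ branches (with $\mathrm{val}(p)\neq 2$ for only finitely many $p$), equipped with a complete inner metric. The complete metric graph $K_d$ on $d$ vertices is the metric realization of the complete graph on $d$ vertices, where the edges have arbitrary (positive, finite) lengths. Omitting an edge means removing its interior; all $d$ vertices are kept. The notation $K_d\setminus K_h$ (with $h<d$) means that one omits the $\binom{h}{2}$ edges forming the complete graph on $h$ of the $d$ vertices. A divisor on $\Gamma$ is an element $D=\sum_{p} a_p(p)$ of the free abelian group on the points of $\Gamma$; its degree is $\sum_p a_p$; it is effective ($D\geq 0$) if all $a_p\ge 0$. A rational function on $\Gamma$ is a continuous piecewise linear function $f:\Gamma\to\mathbb{R}$ with integer slopes and finitely many pieces; $\mathrm{div}(f)$ is the divisor whose coefficient at $p$ is the sum of the outgoing slopes of $f$ at $p$. Divisors $D_1,D_2$ are linearly equivalent, $D_1\sim D_2$, if $D_1-D_2=\mathrm{div}(f)$ for some rational function $f$, and $|D|=\{E\ge 0: E\sim D\}$. The rank $\mathrm{rk}_\Gamma(D)$ is $-1$ if $|D|=\emptyset$, and otherwise the maximal integer $r\ge 0$ such that $|D-E|\ne\emptyset$ for all effective divisors $E$ of degree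 $r$. The gonality $\mathrm{gon}(\Gamma)$ is the smallest integer $n$ for which there is a divisor on $\Gamma$ of degree $n$ and rank $1$. *)

theory Defs
  imports "HOL-Analysis.Analysis" "HOL-Library.Poly_Mapping"
begin

text \<open>
  Meant for finite simple graphs: edges are two-element sets of vertices.
\<close>

record 'v weighted_graph =
  verts :: "'v set"
  edges :: "'v set set"
  edge_len :: "'v set \<Rightarrow> real"

definition arcs :: "'v weighted_graph \<Rightarrow> ('v \<times> 'v) set" where
  "arcs G = {(u, v). u \<noteq> v \<and> {u, v} \<in> edges G}"

text \<open>
  The metric realization is the geometric realization in barycentric coordinates, a set of functions
  \<open>'v \<Rightarrow> real\<close> carrying the subspace topology. The inner metric is the one for which every
  map \<open>edge_point G u v\<close> on \<open>{0..edge_len G {u, v}}\<close> is the arc-length parametrization, starting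
  at \<open>u\<close>, of the edge \<open>{u, v}\<close>; both orientations of an edge occur. Slopes are always taken
  with respect to these parametrizations.
\<close>

definition edge_point :: "'v weighted_graph \<Rightarrow> 'v \<Rightarrow> 'v \<Rightarrow> real \<Rightarrow> ('v \<Rightarrow> real)" where
  "edge_point G u v t =
     (\<lambda>w. if w = u then 1 - t / edge_len G {u, v}
          else if w = v then t / edge_len G {u, v}
          else 0)"

definition points :: "'v weighted_graph \<Rightarrow> ('v \<Rightarrow> real) set" where
  "points G =
     (\<lambda>v. indicat_real {v}) ` verts G \<union>
     (\<Union>(u, v)\<in>arcs G. edge_point G u v ` {0..edge_len G {u, v}})"

definition complete_graph :: "'v set \<Rightarrow> ('v set \<Rightarrow> real) \<Rightarrow> 'v weighted_graph" where
  "complete_graph V l = \<lparr>verts = V, edges = {e. e \<subseteq> V \<and> card e = 2}, edge_len = l\<rparr>"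

definition omit_edges_within :: "'v weighted_graph \<Rightarrow> 'v set \<Rightarrow> 'v weighted_graph" where
  "omit_edges_within G H = G\<lparr>edges := {e \<in> edges G. \<not> e \<subseteq> H}\<rparr>"

text \<open>
  \<open>S\<close> is the finite set of break points: on every subinterval whose interior avoids \<open>S\<close>
  the function is affine with an integer slope.
\<close>

definition piecewise_linear_int :: "real \<Rightarrow> (real \<Rightarrow> real) \<Rightarrow> bool" where
  "piecewise_linear_int L g \<longleftrightarrow>
     (\<exists>S. finite S \<and>
        (\<forall>a b. 0 \<le> a \<and> a < b \<and> b \<le> L \<and> {a<..<b} \<inter> S = {} \<longrightarrow>
           (\<exists>m::int. \<forall>s\<in>{a..b}. g s = g a + of_int m * (s - a))))"

definition rational_function :: "'v weighted_graph \<Rightarrow> (('v \<Rightarrow> real) \<Rightarrow> real) \<Rightarrow> bool" where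
  "rational_function G f \<longleftrightarrow>
     continuous_on (points G) f \<and>
     (\<forall>(u, v)\<in>arcs G. piecewise_linear_int (edge_len G {u, v}) (\<lambda>s. f (edge_point G u v s)))"

text \<open>
  A tangent direction at \<open>p\<close> is an oriented edge along which \<open>p\<close> is not the final point, together
  with the parameter of \<open>p\<close>. An interior point of an edge has two directions, one for each
  orientation; a vertex has one for each incident edge.
\<close>

definition directions :: "'v weighted_graph \<Rightarrow> ('v \<Rightarrow> real) \<Rightarrow> ('v \<times> 'v \<times> real) set" where
  "directions G p =
     {(u, v, t). (u, v) \<in> arcs G \<and> 0 \<le> t \<and> t < edge_len G {u, v} \<and> edge_point G u v t = p}"

definition outgoing_slope ::
    "'v weighted_graph \<Rightarrow> (('v \<Rightarrow> real) \<Rightarrow> real) \<Rightarrow> 'v \<times> 'v \<times> real \<Rightarrow> real" where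
  "outgoing_slope G f =
     (\<lambda>(u, v, t). vector_derivative (\<lambda>s. f (edge_point G u v s)) (at_right t))"

type_synonym 'v divisor = "('v \<Rightarrow> real) \<Rightarrow>\<^sub>0 int"

definition divisor_on :: "'v weighted_graph \<Rightarrow> 'v divisor \<Rightarrow> bool" where
  "divisor_on G D \<longleftrightarrow> Poly_Mapping.keys D \<subseteq> points G"

definition deg :: "'v divisor \<Rightarrow> int" where
  "deg D = (\<Sum>p\<in>Poly_Mapping.keys D. Poly_Mapping.lookup D p)"

definition effective :: "'v divisor \<Rightarrow> bool" where
  "effective D \<longleftrightarrow> (\<forall>p. 0 \<le> Poly_Mapping.lookup D p)"

definition is_div :: "'v weighted_graph \<Rightarrow> (('v \<Rightarrow> real) \<Rightarrow> real) \<Rightarrow> 'v divisor \<Rightarrow> bool" where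
  "is_div G f D \<longleftrightarrow>
     divisor_on G D \<and>
     (\<forall>p\<in>points G. of_int (Poly_Mapping.lookup D p) = (\<Sum>x\<in>directions G p. outgoing_slope G f x))"

definition lin_equiv :: "'v weighted_graph \<Rightarrow> 'v divisor \<Rightarrow> 'v divisor \<Rightarrow> bool" where
  "lin_equiv G D1 D2 \<longleftrightarrow> (\<exists>f. rational_function G f \<and> is_div G f (D1 - D2))"

definition linear_system :: "'v weighted_graph \<Rightarrow> 'v divisor \<Rightarrow> 'v divisor set" where
  "linear_system G D = {E. divisor_on G E \<and> effective E \<and> lin_equiv G E D}"

definition divisor_rank :: "'v weighted_graph \<Rightarrow> 'v divisor \<Rightarrow> int" where
  "divisor_rank G D =
     (if linear_system G D = {} then - 1
      else int (GREATEST r::nat. \<forall>E. divisor_on G E \<and> effective E \<and> deg E = int r \<longrightarrow>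
                                   linear_system G (D - E) \<noteq> {}))"

definition gonality :: "'v weighted_graph \<Rightarrow> int" where
  "gonality G = (LEAST n::int. \<exists>D. divisor_on G D \<and> deg D = n \<and> divisor_rank G D = 1)"

end

theory Submission
  imports Defs
begin

text \<open>
  Write \<open>C = V - H\<close> and \<open>k = card C = d - h\<close>, and think of an effective divisor as a collection of chips.

  Lower bound. Let \<open>D\<close> have positive rank and degree less than \<open>k\<close>; it may be taken effective. Let \<open>E\<close> be
  effective with \<open>E - D = div f\<close>, and let \<open>A\<close> be the set of vertices at which \<open>f\<close> attains its maximum
  over all vertices. Along each edge, the change of slope of \<open>f\<close> between two points is the degree of
  \<open>div f\<close> on the segment between them (\<open>mass_open_segment\<close>). Summing over all edges that meet \<open>A\<close> shows
  that \<open>D\<close> has at least as many chips as there are edges leaving \<open>A\<close> (\<open>card_cut_le_deg\<close>). But in the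
  graph at hand at least \<open>k\<close> edges leave every proper nonempty set of vertices
  (\<open>edge_cut_complete_minus_complete\<close>), so \<open>f\<close> is constant on the vertices. Now let \<open>q\<close> be a vertex
  without a chip of \<open>D\<close>, and choose \<open>E\<close> with a chip at \<open>q\<close>. Then \<open>f\<close> increases along some edge at \<open>q\<close> and
  returns to its old value at the other end, which takes two chips of \<open>D\<close> inside this edge
  (\<open>chip_near_vertex\<close>). Since an edge has only two ends, \<open>D\<close> has at least as many chips as there
  are vertices (\<open>card_verts_le_deg\<close>), contradicting \<open>k \<le> d\<close>.

  Upper bound. The sum of the vertices in \<open>C\<close> has positive rank. A point on an edge inside \<open>C\<close> is
  reached by moving the chips at both ends towards each other (\<open>lin_equiv_move_pair\<close>). For
  \<open>x \<in> H\<close>, whose neighbours are exactly the vertices in \<open>C\<close>, move all chips towards \<open>x\<close>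
  (\<open>lin_equiv_fire_towards\<close>) until the shortest edge has been traversed; from then on there is a chip
  at \<open>x\<close>, and what remains of any other edge at \<open>x\<close> lies between two chips.

  Finally, subtracting \<open>r - 1\<close> chips from a divisor of rank at least \<open>r\<close> leaves positive rank, so by the
  lower bound a divisor of degree \<open>k\<close> and positive rank has rank exactly \<open>1\<close> (\<open>gonality_eqI\<close>).
\<close>

section \<open>Piecewise linear functions on an interval\<close>

lemma has_vector_derivative_right_affine:
  fixes g :: "real \<Rightarrow> real"
  assumes "t < b" and "\<And>s. t \<le> s \<Longrightarrow> s \<le> b \<Longrightarrow> g s = g t + m * (s - t)"
  shows "(g has_vector_derivative m) (at_right t)"
proof -
  have "((\<lambda>s. g t + m * (s - t)) has_vector_derivative m) (at t within {t..})"
    by (auto intro!: derivative_eq_intros simp flip: has_real_derivative_iff_has_vector_derivative)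
  then have "(g has_vector_derivative m) (at t within {t..})"
    by (rule has_vector_derivative_transform_within[where d = "b - t"])
      (use assms(1) in \<open>auto simp: dist_real_def intro!: assms(2)[symmetric]\<close>)
  then show ?thesis
    by (simp add: at_within_Ici_at_right)
qed

lemma vector_derivative_right_affine:
  fixes g :: "real \<Rightarrow> real"
  assumes "t < b" and "\<And>s. t \<le> s \<Longrightarrow> s \<le> b \<Longrightarrow> g s = g t + m * (s - t)"
  shows "vector_derivative g (at_right t) = m"
  using has_vector_derivative_right_affine[OF assms]
  by (intro vector_derivative_within) auto

lemma piecewise_linear_int_right_affine:
  assumes "piecewise_linear_int L g" and "0 \<le> t" and "t < L"
  obtains b and m :: int where "t < b" and "b \<le> L"
    and "\<And>s. t \<le> s \<Longrightarrow> s \<le> b \<Longrightarrow> g s = g t + of_int m * (s - t)"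
proof -
  obtain S where S: "finite S"
    and aff: "\<And>a b. 0 \<le> a \<and> a < b \<and> b \<le> L \<and> {a<..<b} \<inter> S = {} \<Longrightarrow>
                \<exists>m::int. \<forall>s\<in>{a..b}. g s = g a + of_int m * (s - a)"
    using assms(1) unfolding piecewise_linear_int_def by blast
  define b where "b = Min (insert L {s \<in> S. t < s})"
  have b: "t < b" "b \<le> L"
    using S assms(3) by (auto simp: b_def)
  have "b \<le> s" if "s \<in> S" "t < s" for s
    using S that by (auto simp: b_def)
  then have "{t<..<b} \<inter> S = {}"
    by fastforce
  with b assms(2) aff[of t b] obtain m :: int
    where "\<forall>s\<in>{t..b}. g s = g t + of_int m * (s - t)" by blast
  then have "\<And>s. t \<le> s \<Longrightarrow> s \<le> b \<Longrightarrow> g s = g t + of_int m * (s - t)"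
    by (meson atLeastAtMost_iff)
  with b show thesis
    by (rule that)
qed

text \<open>
  To prove a property of all subintervals for a piecewise linear function, it suffices to prove it
  where the function is affine, and to glue adjacent intervals.
\<close>

lemma piecewise_linear_int_induct:
  assumes "piecewise_linear_int L g" and "0 \<le> x" and "x < y" and "y \<le> L"
    and affine: "\<And>a b (m::int). 0 \<le> a \<Longrightarrow> a < b \<Longrightarrow> b \<le> L \<Longrightarrow>
      (\<And>s. a \<le> s \<Longrightarrow> s \<le> b \<Longrightarrow> g s = g a + of_int m * (s - a)) \<Longrightarrow> P a b"
    and glue: "\<And>a b c. 0 \<le> a \<Longrightarrow> a < b \<Longrightarrow> b < c \<Longrightarrow> c \<le> L \<Longrightarrow> P a b \<Longrightarrow> P b c \<Longrightarrow> P a c"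
  shows "P x y"
proof -
  obtain S where S: "finite S"
    and aff: "\<And>a b. 0 \<le> a \<and> a < b \<and> b \<le> L \<and> {a<..<b} \<inter> S = {} \<Longrightarrow>
                \<exists>m::int. \<forall>s\<in>{a..b}. g s = g a + of_int m * (s - a)"
    using assms(1) unfolding piecewise_linear_int_def by blast
  show ?thesis
    using assms(2-4)
  proof (induction "card ({x<..<y} \<inter> S)" arbitrary: x y rule: less_induct)
    case less
    show ?case
    proof (cases "{x<..<y} \<inter> S = {}")
      case True
      with aff[of x y] less.prems obtain m :: int
        where "\<forall>s\<in>{x..y}. g s = g x + of_int m * (s - x)" by blast
      then have "\<And>s. x \<le> s \<Longrightarrow> s \<le> y \<Longrightarrow> g s = g x + of_int m * (s - x)"
        by (meson atLeastAtMost_iff)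
      with less.prems show ?thesis by (rule affine)
    next
      case False
      then obtain t where t: "t \<in> S" "x < t" "t < y" by auto
      have "card ({x<..<t} \<inter> S) < card ({x<..<y} \<inter> S)"
        "card ({t<..<y} \<inter> S) < card ({x<..<y} \<inter> S)"
        using S t by (auto intro!: psubset_card_mono)
      then have "P x t" "P t y"
        using less t by auto
      with glue[of x t y] t less.prems show ?thesis by simp
    qed
  qed
qed

lemma piecewise_linear_int_diff:
  assumes "piecewise_linear_int L g" and "piecewise_linear_int L h"
  shows "piecewise_linear_int L (\<lambda>s. g s - h s)"
proof -
  obtain S T where fin: "finite S" "finite T"
    and S: "\<And>a b. 0 \<le> a \<and> a < b \<and> b \<le> L \<and> {a<..<b} \<inter> S = {} \<Longrightarrow>
                \<exists>m::int. \<forall>s\<in>{a..b}. g s = g a + of_int m * (s - a)"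
    and T: "\<And>a b. 0 \<le> a \<and> a < b \<and> b \<le> L \<and> {a<..<b} \<inter> T = {} \<Longrightarrow>
                \<exists>m::int. \<forall>s\<in>{a..b}. h s = h a + of_int m * (s - a)"
    using assms unfolding piecewise_linear_int_def by blast
  show ?thesis
    unfolding piecewise_linear_int_def
  proof (intro exI[of _ "S \<union> T"] conjI allI impI)
    fix a b assume ab: "0 \<le> a \<and> a < b \<and> b \<le> L \<and> {a<..<b} \<inter> (S \<union> T) = {}"
    obtain m n :: int where "\<forall>s\<in>{a..b}. g s = g a + of_int m * (s - a)"
      "\<forall>s\<in>{a..b}. h s = h a + of_int n * (s - a)"
      using S[of a b] T[of a b] ab by blast
    then show "\<exists>m::int. \<forall>s\<in>{a..b}. g s - h s = g a - h a + of_int m * (s - a)"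
      by (intro exI[of _ "m - n"]) (auto simp: algebra_simps)
  qed (use fin in simp)
qed

lemma vector_derivative_right_diff:
  assumes "piecewise_linear_int L g" and "piecewise_linear_int L h" and "0 \<le> t" and "t < L"
  shows "vector_derivative (\<lambda>s. g s - h s) (at_right t) =
         vector_derivative g (at_right t) - vector_derivative h (at_right t)"
proof -
  obtain b m where g: "t < b" "\<And>s. t \<le> s \<Longrightarrow> s \<le> b \<Longrightarrow> g s = g t + of_int m * (s - t)"
    using piecewise_linear_int_right_affine[OF assms(1,3,4)] by metis
  obtain c n where h: "t < c" "\<And>s. t \<le> s \<Longrightarrow> s \<le> c \<Longrightarrow> h s = h t + of_int n * (s - t)"
    using piecewise_linear_int_right_affine[OF assms(2,3,4)] by metis
  have eq: "g s - h s = g t - h t + (of_int m - of_int n) * (s - t)"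
    if "t \<le> s" "s \<le> min b c" for s
    using that g(2)[of s] h(2)[of s] by (simp add: algebra_simps)
  have "vector_derivative (\<lambda>s. g s - h s) (at_right t) = of_int m - of_int n"
    by (rule vector_derivative_right_affine[where b = "min b c" and g = "\<lambda>s. g s - h s"])
      (use g(1) h(1) in simp, fact eq)
  moreover have "vector_derivative g (at_right t) = of_int m"
    using g by (rule vector_derivative_right_affine[where g = g and b = b])
  moreover have "vector_derivative h (at_right t) = of_int n"
    using h by (rule vector_derivative_right_affine[where g = h and b = c])
  ultimately show ?thesis by simp
qed

text \<open>Slopes are integers, so slopes above \<open>-1\<close> are nonnegative.\<close>

lemma piecewise_linear_int_mono:
  assumes g: "piecewise_linear_int L g" and "0 \<le> x" and "x < y" and "y \<le> L"
    and "\<And>t. x \<le> t \<Longrightarrow> t < y \<Longrightarrow> vector_derivative g (at_right t) > - 1"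
  shows "g x \<le> g y \<and> (vector_derivative g (at_right x) > 0 \<longrightarrow> g x < g y)"
proof -
  define P where "P a b \<longleftrightarrow> (\<forall>t. a \<le> t \<and> t < b \<longrightarrow> vector_derivative g (at_right t) > - 1) \<longrightarrow>
      g a \<le> g b \<and> (vector_derivative g (at_right a) > 0 \<longrightarrow> g a < g b)" for a b
  have "P x y"
    using g assms(2-4)
  proof (rule piecewise_linear_int_induct)
    fix a b :: real and m :: int
    assume ab: "a < b" and aff: "\<And>s. a \<le> s \<Longrightarrow> s \<le> b \<Longrightarrow> g s = g a + of_int m * (s - a)"
    have d: "vector_derivative g (at_right a) = of_int m"
      using ab aff by (rule vector_derivative_right_affine[where g = g and b = b])
    have gb: "g b = g a + of_int m * (b - a)"
      by (rule aff) (use ab in linarith)+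
    show "P a b"
      unfolding P_def
    proof (intro impI)
      assume "\<forall>t. a \<le> t \<and> t < b \<longrightarrow> vector_derivative g (at_right t) > - 1"
      then have "(of_int m :: real) > - 1"
        using ab by (simp flip: d)
      then have "m \<ge> 0"
        by linarith
      then show "g a \<le> g b \<and> (vector_derivative g (at_right a) > 0 \<longrightarrow> g a < g b)"
        unfolding d gb using ab by simp
    qed
  next
    fix a b c :: real
    assume abc: "a < b" "b < c" and "P a b" and "P b c"
    show "P a c"
      unfolding P_def
    proof (intro impI)
      assume *: "\<forall>t. a \<le> t \<and> t < c \<longrightarrow> vector_derivative g (at_right t) > - 1"
      then have "g a \<le> g b \<and> (vector_derivative g (at_right a) > 0 \<longrightarrow> g a < g b)"
        using \<open>P a b\<close> abc unfolding P_def by auto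
      moreover have "g b \<le> g c"
        using * \<open>P b c\<close> abc unfolding P_def by auto
      ultimately show "g a \<le> g c \<and> (vector_derivative g (at_right a) > 0 \<longrightarrow> g a < g c)"
        by auto
    qed
  qed
  moreover have "\<forall>t. x \<le> t \<and> t < y \<longrightarrow> vector_derivative g (at_right t) > - 1"
    using assms(5) by simp
  ultimately show ?thesis
    unfolding P_def by (rule mp)
qed

section \<open>Divisors restricted to sets of points\<close>

text \<open>The part of the degree of a divisor that is carried by the points in \<open>X\<close>.\<close>

definition mass :: "'v divisor \<Rightarrow> ('v \<Rightarrow> real) set \<Rightarrow> int" where
  "mass D X = (\<Sum>p\<in>Poly_Mapping.keys D \<inter> X. Poly_Mapping.lookup D p)"

lemma mass_eq_sum:
  assumes "finite K" and "Poly_Mapping.keys D \<inter> X \<subseteq> K" and "K \<subseteq> X"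
  shows "mass D X = (\<Sum>p\<in>K. Poly_Mapping.lookup D p)"
  unfolding mass_def using assms
  by (intro sum.mono_neutral_left) (auto simp: in_keys_iff)

lemma deg_eq_mass: "deg D = mass D UNIV"
  by (simp add: deg_def mass_def)

lemma mass_add: "mass (D + E) X = mass D X + mass E X"
proof -
  let ?K = "(Poly_Mapping.keys D \<union> Poly_Mapping.keys E) \<inter> X"
  have "mass (D + E) X = (\<Sum>p\<in>?K. Poly_Mapping.lookup (D + E) p)"
    by (rule mass_eq_sum) (auto simp: in_keys_iff lookup_add)
  also have "\<dots> = (\<Sum>p\<in>?K. Poly_Mapping.lookup D p) + (\<Sum>p\<in>?K. Poly_Mapping.lookup E p)"
    by (simp add: lookup_add sum.distrib)
  also have "\<dots> = mass D X + mass E X"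
    by (intro arg_cong2[of _ _ _ _ "(+)"] mass_eq_sum[symmetric]) auto
  finally show ?thesis .
qed

lemma mass_diff: "mass (D - E) X = mass D X - mass E X"
  using mass_add[of "D - E" E X] by simp

lemma deg_add: "deg (D + E) = deg D + deg E"
  and deg_diff: "deg (D - E) = deg D - deg E"
  by (simp_all add: deg_eq_mass mass_add mass_diff)

lemma mass_singleton: "mass D {p} = Poly_Mapping.lookup D p"
  by (subst mass_eq_sum[where K = "{p}"]) auto

lemma mass_Un_disjoint:
  assumes "X \<inter> Y = {}"
  shows "mass D (X \<union> Y) = mass D X + mass D Y"
  unfolding mass_def using assms
  unfolding Int_Un_distrib by (intro sum.union_disjoint) auto

lemma mass_eq_0: "(\<And>p. p \<in> X \<Longrightarrow> Poly_Mapping.lookup D p = 0) \<Longrightarrow> mass D X = 0"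
  unfolding mass_def by (intro sum.neutral) auto

lemma mass_nonneg: "effective D \<Longrightarrow> 0 \<le> mass D X"
  unfolding mass_def effective_def by (intro sum_nonneg) auto

lemma mass_mono: "effective D \<Longrightarrow> X \<subseteq> Y \<Longrightarrow> mass D X \<le> mass D Y"
  unfolding mass_def effective_def by (intro sum_mono2) auto

lemma lookup_le_deg: "effective D \<Longrightarrow> Poly_Mapping.lookup D p \<le> deg D"
  using mass_mono[of D "{p}" UNIV] by (simp add: mass_singleton deg_eq_mass)

lemma deg_single: "deg (Poly_Mapping.single p a) = a"
  by (simp add: deg_def)

lemma effective_add: "effective D \<Longrightarrow> effective E \<Longrightarrow> effective (D + E)"
  by (simp add: effective_def lookup_add)

lemma effective_single: "0 \<le> a \<Longrightarrow> effective (Poly_Mapping.single p a)"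
  by (simp add: effective_def lookup_single when_def)

lemma divisor_on_add: "divisor_on G D \<Longrightarrow> divisor_on G E \<Longrightarrow> divisor_on G (D + E)"
  unfolding divisor_on_def using keys_add[of D E] by blast

lemma divisor_on_diff: "divisor_on G D \<Longrightarrow> divisor_on G E \<Longrightarrow> divisor_on G (D - E)"
  unfolding divisor_on_def by (auto simp: in_keys_iff lookup_minus subset_eq)

lemma divisor_on_single: "p \<in> points G \<Longrightarrow> divisor_on G (Poly_Mapping.single p a)"
  by (simp add: divisor_on_def)

lemma effective_deg_1:
  assumes "effective D" and "deg D = 1"
  obtains p where "D = Poly_Mapping.single p 1" and "p \<in> Poly_Mapping.keys D"
proof -
  have "Poly_Mapping.keys D \<noteq> {}"
    using assms(2) by (auto simp: deg_def)
  then obtain p where p: "p \<in> Poly_Mapping.keys D"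
    by (meson ex_in_conv)
  have ge: "Poly_Mapping.lookup D p \<ge> 1"
    using assms(1) p by (simp add: effective_def in_keys_iff int_one_le_iff_zero_less order_less_le)
  have "Poly_Mapping.lookup D q = (1 when p = q)" for q
  proof (cases "p = q")
    case True
    with ge lookup_le_deg[OF assms(1), of p] assms(2) show ?thesis by simp
  next
    case False
    have "mass D {p, q} = Poly_Mapping.lookup D p + Poly_Mapping.lookup D q"
      using False mass_Un_disjoint[of "{p}" "{q}" D] by (simp add: mass_singleton insert_commute)
    moreover have "mass D {p, q} \<le> 1"
      using mass_mono[OF assms(1), of "{p, q}" UNIV] assms(2) by (simp add: deg_eq_mass)
    ultimately show ?thesis
      using False ge assms(1) by (simp add: effective_def) (smt (verit))
  qed
  then have "D = Poly_Mapping.single p 1"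
    by (intro poly_mapping_eqI) (simp add: lookup_single)
  with p that show thesis by blast
qed

section \<open>Points, tangent directions and divisors of rational functions\<close>

text \<open>The point of the metric realization that is the vertex \<open>v\<close>.\<close>

abbreviation vertex_point :: "'v \<Rightarrow> ('v \<Rightarrow> real)" where
  "vertex_point v \<equiv> indicat_real {v}"

text \<open>
  For an edge \<open>e\<close>, the points in its interior; these are the points whose barycentric coordinates
  are supported exactly on \<open>e\<close>.
\<close>

definition open_edge :: "'v weighted_graph \<Rightarrow> 'v set \<Rightarrow> ('v \<Rightarrow> real) set" where
  "open_edge G e = {p \<in> points G. {w. p w \<noteq> 0} = e}"

text \<open>
  The slope of \<open>f\<close> on the edge \<open>{u, v}\<close> in the direction of \<open>v\<close>, to the right of the point at distance
  \<open>t\<close> from \<open>u\<close>. The slope in the direction of \<open>u\<close> at the same point is taken at \<open>edge_len G {u, v} - t\<close>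
  on the reversed edge.
\<close>

abbreviation slope :: "'v weighted_graph \<Rightarrow> (('v \<Rightarrow> real) \<Rightarrow> real) \<Rightarrow> 'v \<Rightarrow> 'v \<Rightarrow> real \<Rightarrow> real" where
  "slope G f u v t \<equiv> outgoing_slope G f (u, v, t)"

text \<open>The edges with exactly one end in \<open>A\<close>.\<close>

definition edge_cut :: "'v weighted_graph \<Rightarrow> 'v set \<Rightarrow> 'v set set" where
  "edge_cut G A = {e \<in> edges G. e \<inter> A \<noteq> {} \<and> \<not> e \<subseteq> A}"

text \<open>Finite simple graphs with positive edge lengths; they need not be connected.\<close>

locale finite_metric_graph =
  fixes G :: "'v weighted_graph"
  assumes finite_verts: "finite (verts G)"
    and edge_subset: "e \<in> edges G \<Longrightarrow> e \<subseteq> verts G"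
    and card_edge: "e \<in> edges G \<Longrightarrow> card e = 2"
    and edge_len_pos: "e \<in> edges G \<Longrightarrow> 0 < edge_len G e"
begin

lemma finite_edges: "finite (edges G)"
  by (rule finite_subset[of _ "Pow (verts G)"]) (use edge_subset finite_verts in auto)

lemma arcD:
  assumes "(u, v) \<in> arcs G"
  shows "u \<noteq> v" "{u, v} \<in> edges G" "u \<in> verts G" "v \<in> verts G" "0 < edge_len G {u, v}"
  using assms edge_subset[of "{u, v}"] edge_len_pos[of "{u, v}"] by (auto simp: arcs_def)

lemma arc_commute: "(u, v) \<in> arcs G \<longleftrightarrow> (v, u) \<in> arcs G"
  by (auto simp: arcs_def insert_commute)

lemma finite_arcs: "finite (arcs G)"
  by (rule finite_subset[of _ "verts G \<times> verts G"]) (use finite_verts arcD in auto)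

lemma edgeE:
  assumes "e \<in> edges G"
  obtains u v where "e = {u, v}" and "(u, v) \<in> arcs G"
  using assms card_edge[OF assms] unfolding card_2_iff arcs_def by auto

lemma edge_point_0: "(u, v) \<in> arcs G \<Longrightarrow> edge_point G u v 0 = vertex_point u"
  by (auto simp: edge_point_def indicator_def)

lemma edge_point_len: "(u, v) \<in> arcs G \<Longrightarrow> edge_point G u v (edge_len G {u, v}) = vertex_point v"
  using arcD[of u v] by (auto simp: edge_point_def indicator_def fun_eq_iff)

lemma edge_point_reverse:
  "(u, v) \<in> arcs G \<Longrightarrow> edge_point G v u s = edge_point G u v (edge_len G {u, v} - s)"
  using arcD[of u v] by (auto simp: edge_point_def fun_eq_iff insert_commute field_simps)

lemma edge_point_eq_iff:
  "(u, v) \<in> arcs G \<Longrightarrow> edge_point G u v s = edge_point G u v t \<longleftrightarrow> s = t"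
  using arcD[of u v] by (auto simp: edge_point_def fun_eq_iff split: if_splits)

lemma vertex_point_eq_iff: "vertex_point u = vertex_point v \<longleftrightarrow> u = v"
  by (auto simp: indicator_def fun_eq_iff split: if_splits)

lemma support_vertex_point: "{w. vertex_point v w \<noteq> (0::real)} = {v}"
  by (auto simp: indicator_def)

lemma support_edge_point:
  assumes "(u, v) \<in> arcs G" and "0 < t" and "t < edge_len G {u, v}"
  shows "{w. edge_point G u v t w \<noteq> 0} = {u, v}"
  using arcD[OF assms(1)] assms by (auto simp: edge_point_def field_simps)

lemma vertex_point_in_points: "v \<in> verts G \<Longrightarrow> vertex_point v \<in> points G"
  by (auto simp: points_def)

lemma edge_point_in_points:
  "(u, v) \<in> arcs G \<Longrightarrow> 0 \<le> t \<Longrightarrow> t \<le> edge_len G {u, v} \<Longrightarrow> edge_point G u v t \<in> points G"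
  by (force simp: points_def)

lemma points_cases:
  assumes "p \<in> points G"
  obtains (vertex) v where "v \<in> verts G" and "p = vertex_point v"
  | (interior) u v t where "(u, v) \<in> arcs G" and "0 < t" and "t < edge_len G {u, v}"
      and "p = edge_point G u v t"
proof -
  from assms consider v where "v \<in> verts G" "p = vertex_point v"
    | u v t where "(u, v) \<in> arcs G" "0 \<le> t" "t \<le> edge_len G {u, v}" "p = edge_point G u v t"
    unfolding points_def by auto
  then show thesis
  proof cases
    case (2 u v t)
    then consider "t = 0" | "t = edge_len G {u, v}" | "0 < t" "t < edge_len G {u, v}"
      by linarith
    then show thesis
      using 2 interior vertex edge_point_0 edge_point_len arcD by cases metis+
  qed (use vertex in blast)
qed

lemma open_edge_eq:
  assumes "(u, v) \<in> arcs G"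
  shows "open_edge G {u, v} = edge_point G u v ` {0<..<edge_len G {u, v}}"
proof (intro equalityI subsetI)
  fix p assume "p \<in> open_edge G {u, v}"
  then have p: "p \<in> points G" and supp: "{w. p w \<noteq> 0} = {u, v}"
    by (auto simp: open_edge_def)
  from p show "p \<in> edge_point G u v ` {0<..<edge_len G {u, v}}"
  proof (cases rule: points_cases)
    case (vertex w)
    with supp support_vertex_point[of w] arcD(1)[OF assms] show ?thesis
      by (metis insertI1 insert_commute singletonD)
  next
    case (interior x y t)
    with supp support_edge_point[of x y t] have "{x, y} = {u, v}" by metis
    then consider "x = u" "y = v" | "x = v" "y = u"
      by (auto simp: doubleton_eq_iff)
    then show ?thesis
    proof cases
      case 2
      with interior edge_point_reverse[OF assms, of t]
      have "p = edge_point G u v (edge_len G {u, v} - t)" by simp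
      moreover have "edge_len G {u, v} - t \<in> {0<..<edge_len G {u, v}}"
        using 2 interior by (auto simp: insert_commute)
      ultimately show ?thesis by blast
    qed (use interior in auto)
  qed
next
  fix p assume "p \<in> edge_point G u v ` {0<..<edge_len G {u, v}}"
  then show "p \<in> open_edge G {u, v}"
    unfolding open_edge_def
    by (clarsimp simp: support_edge_point[OF assms] edge_point_in_points[OF assms])
qed

lemma directions_vertex:
  assumes "v \<in> verts G"
  shows "directions G (vertex_point v) = (\<lambda>w. (v, w, 0)) ` {w. (v, w) \<in> arcs G}"
proof (intro equalityI subsetI)
  fix x assume "x \<in> directions G (vertex_point v)"
  then obtain u w t where x: "x = (u, w, t)" "(u, w) \<in> arcs G" "0 \<le> t" "t < edge_len G {u, w}"
    "edge_point G u w t = vertex_point v"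
    by (auto simp: directions_def)
  have "\<not> 0 < t"
  proof
    assume "0 < t"
    with x support_edge_point[of u w t] support_vertex_point[of v] have "{u, w} = {v}"
      by metis
    with arcD(1)[OF x(2)] show False by (metis doubleton_eq_iff insert_absorb2)
  qed
  with x have "t = 0" by simp
  with x edge_point_0[OF x(2)] have "u = v"
    by (simp add: vertex_point_eq_iff)
  with x \<open>t = 0\<close> show "x \<in> (\<lambda>w. (v, w, 0)) ` {w. (v, w) \<in> arcs G}" by auto
next
  fix x :: "'v \<times> 'v \<times> real" assume "x \<in> (\<lambda>w. (v, w, 0)) ` {w. (v, w) \<in> arcs G}"
  then show "x \<in> directions G (vertex_point v)"
    using arcD edge_point_0 by (auto simp: directions_def)
qed

lemma directions_interior:
  assumes "(u, v) \<in> arcs G" and "0 < t" and "t < edge_len G {u, v}"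
  shows "directions G (edge_point G u v t) = {(u, v, t), (v, u, edge_len G {u, v} - t)}"
proof (intro equalityI subsetI)
  fix x assume "x \<in> directions G (edge_point G u v t)"
  then obtain y z s where x: "x = (y, z, s)" "(y, z) \<in> arcs G" "0 \<le> s" "s < edge_len G {y, z}"
    "edge_point G y z s = edge_point G u v t"
    by (auto simp: directions_def)
  have "s \<noteq> 0"
  proof
    assume "s = 0"
    with x support_edge_point[OF assms] edge_point_0[of y z] support_vertex_point[of y]
    have "{y} = {u, v}" by metis
    with arcD(1)[OF assms(1)] show False by (metis doubleton_eq_iff insert_absorb2)
  qed
  with x support_edge_point[OF assms] support_edge_point[of y z s]
  have "{y, z} = {u, v}" by (metis order_le_less)
  then consider "y = u" "z = v" | "y = v" "z = u"
    by (auto simp: doubleton_eq_iff)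
  then show "x \<in> {(u, v, t), (v, u, edge_len G {u, v} - t)}"
  proof cases
    case 1
    with x edge_point_eq_iff[OF assms(1)] show ?thesis by auto
  next
    case 2
    with x edge_point_eq_iff[OF assms(1)] edge_point_reverse[OF assms(1), of s] show ?thesis by auto
  qed
next
  fix x assume x: "x \<in> {(u, v, t), (v, u, edge_len G {u, v} - t)}"
  have "(v, u) \<in> arcs G" "edge_len G {v, u} = edge_len G {u, v}"
    using assms(1) arc_commute by (auto simp: insert_commute)
  with x show "x \<in> directions G (edge_point G u v t)"
    using assms edge_point_reverse[OF assms(1)] by (auto simp: directions_def)
qed

lemma sum_directions_vertex:
  assumes "v \<in> verts G"
  shows "(\<Sum>x\<in>directions G (vertex_point v). F x) = (\<Sum>w | (v, w) \<in> arcs G. F (v, w, 0))"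
  unfolding directions_vertex[OF assms] by (subst sum.reindex) (auto simp: inj_on_def)

lemma sum_directions_interior:
  assumes "(u, v) \<in> arcs G" and "0 < t" and "t < edge_len G {u, v}"
  shows "(\<Sum>x\<in>directions G (edge_point G u v t). F x) = F (u, v, t) + F (v, u, edge_len G {u, v} - t)"
  unfolding directions_interior[OF assms] using arcD(1)[OF assms(1)] by simp

lemma is_div_vertex:
  assumes "is_div G f Z" and "v \<in> verts G"
  shows "of_int (Poly_Mapping.lookup Z (vertex_point v)) = (\<Sum>w | (v, w) \<in> arcs G. slope G f v w 0)"
  using assms vertex_point_in_points[OF assms(2)]
  by (simp add: is_div_def sum_directions_vertex)

lemma is_div_interior:
  assumes "is_div G f Z" and "(u, v) \<in> arcs G" and "0 < t" and "t < edge_len G {u, v}"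
  shows "of_int (Poly_Mapping.lookup Z (edge_point G u v t)) =
         slope G f u v t + slope G f v u (edge_len G {u, v} - t)"
  using assms edge_point_in_points[of u v t]
  by (simp add: is_div_def sum_directions_interior)

lemma is_divI:
  assumes "divisor_on G Z"
    and "\<And>v. v \<in> verts G \<Longrightarrow>
      of_int (Poly_Mapping.lookup Z (vertex_point v)) = (\<Sum>w | (v, w) \<in> arcs G. slope G f v w 0)"
    and "\<And>u v t. (u, v) \<in> arcs G \<Longrightarrow> 0 < t \<Longrightarrow> t < edge_len G {u, v} \<Longrightarrow>
      of_int (Poly_Mapping.lookup Z (edge_point G u v t)) =
      slope G f u v t + slope G f v u (edge_len G {u, v} - t)"
  shows "is_div G f Z"
  unfolding is_div_def
proof (intro conjI ballI)
  fix p assume "p \<in> points G"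
  then show "of_int (Poly_Mapping.lookup Z p) = (\<Sum>x\<in>directions G p. outgoing_slope G f x)"
    by (cases rule: points_cases) (simp_all add: assms sum_directions_vertex sum_directions_interior)
qed (fact assms(1))

lemma rational_functionD:
  "rational_function G f \<Longrightarrow> (u, v) \<in> arcs G \<Longrightarrow>
    piecewise_linear_int (edge_len G {u, v}) (\<lambda>s. f (edge_point G u v s))"
  by (auto simp: rational_function_def)

lemma rational_function_diff:
  assumes "rational_function G f" and "rational_function G g"
  shows "rational_function G (\<lambda>p. f p - g p)"
  using assms unfolding rational_function_def
  by (auto intro!: continuous_on_diff piecewise_linear_int_diff)

lemma slope_diff:
  assumes "rational_function G f" and "rational_function G g"
    and "(u, v) \<in> arcs G" and "0 \<le> t" and "t < edge_len G {u, v}"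
  shows "slope G (\<lambda>p. f p - g p) u v t = slope G f u v t - slope G g u v t"
  using vector_derivative_right_diff[OF rational_functionD[OF assms(1,3)]
      rational_functionD[OF assms(2,3)] assms(4,5)]
  by (simp add: outgoing_slope_def)

lemma is_div_diff:
  assumes f: "rational_function G f" "is_div G f Y" and g: "rational_function G g" "is_div G g Z"
  shows "is_div G (\<lambda>p. f p - g p) (Y - Z)"
  unfolding is_div_def
proof (intro conjI ballI)
  show "divisor_on G (Y - Z)"
    using f g by (auto simp: is_div_def intro: divisor_on_diff)
  fix p assume p: "p \<in> points G"
  have "(\<Sum>x\<in>directions G p. outgoing_slope G (\<lambda>p. f p - g p) x) =
      (\<Sum>x\<in>directions G p. outgoing_slope G f x - outgoing_slope G g x)"
    by (intro sum.cong) (auto simp: directions_def slope_diff[OF f(1) g(1)])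
  with f g p show "of_int (Poly_Mapping.lookup (Y - Z) p) =
      (\<Sum>x\<in>directions G p. outgoing_slope G (\<lambda>p. f p - g p) x)"
    by (simp add: is_div_def lookup_minus sum_subtractf)
qed

subsection \<open>The divergence theorem on an edge\<close>

lemma slope_reverse_affine:
  assumes uv: "(u, v) \<in> arcs G" and "a < s" and "s \<le> b"
    and aff: "\<And>r. a \<le> r \<Longrightarrow> r \<le> b \<Longrightarrow>
      f (edge_point G u v r) = f (edge_point G u v a) + m * (r - a)"
  shows "slope G f v u (edge_len G {u, v} - s) = - m"
  unfolding outgoing_slope_def prod.case
proof (rule vector_derivative_right_affine)
  show "edge_len G {u, v} - s < edge_len G {u, v} - a"
    using assms(2) by simp
  fix r assume r: "edge_len G {u, v} - s \<le> r" "r \<le> edge_len G {u, v} - a"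
  have "f (edge_point G v u r) = f (edge_point G u v a) + m * (edge_len G {u, v} - r - a)"
    unfolding edge_point_reverse[OF uv] by (rule aff) (use r assms(3) in auto)
  moreover have "f (edge_point G v u (edge_len G {u, v} - s)) = f (edge_point G u v a) + m * (s - a)"
    unfolding edge_point_reverse[OF uv] using assms(2,3) aff[of s] by simp
  ultimately show "f (edge_point G v u r) =
      f (edge_point G v u (edge_len G {u, v} - s)) + - m * (r - (edge_len G {u, v} - s))"
    by (simp add: algebra_simps)
qed

lemma slope_affine:
  assumes "a \<le> s" and "s < b"
    and aff: "\<And>r. a \<le> r \<Longrightarrow> r \<le> b \<Longrightarrow>
      f (edge_point G u v r) = f (edge_point G u v a) + m * (r - a)"
  shows "slope G f u v s = m"
  unfolding outgoing_slope_def prod.case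
proof (rule vector_derivative_right_affine)
  show "s < b" by fact
  fix r assume "s \<le> r" "r \<le> b"
  then show "f (edge_point G u v r) = f (edge_point G u v s) + m * (r - s)"
    using aff[of r] aff[of s] assms(1,2) by (simp add: algebra_simps)
qed

text \<open>
  The degree of the divisor of \<open>f\<close> on an open segment is the total change of slope along it: the
  outgoing slope at the end of the segment, taken backwards, is minus the slope with which \<open>f\<close> arrives.
\<close>

lemma mass_open_segment:
  assumes f: "rational_function G f" "is_div G f Z" and uv: "(u, v) \<in> arcs G"
    and xy: "0 \<le> x" "x < y" "y \<le> edge_len G {u, v}"
  shows "of_int (mass Z (edge_point G u v ` {x<..<y})) =
         - slope G f u v x - slope G f v u (edge_len G {u, v} - y)"
  using rational_functionD[OF f(1) uv] xy
proof (rule piecewise_linear_int_induct)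
  fix a b :: real and m :: int
  assume ab: "0 \<le> a" "a < b" "b \<le> edge_len G {u, v}"
    and aff: "\<And>s. a \<le> s \<Longrightarrow> s \<le> b \<Longrightarrow>
      f (edge_point G u v s) = f (edge_point G u v a) + of_int m * (s - a)"
  note sl = slope_affine[of a _ b f u v, OF _ _ aff]
    and rsl = slope_reverse_affine[OF uv, of a _ b f, OF _ _ aff]
  have "mass Z (edge_point G u v ` {a<..<b}) = 0"
  proof (rule mass_eq_0, clarify)
    fix t assume t: "t \<in> {a<..<b}"
    then have "slope G f u v t = of_int m" "slope G f v u (edge_len G {u, v} - t) = - of_int m"
      by (auto intro: sl rsl)
    with t ab is_div_interior[OF f(2) uv, of t]
    show "Poly_Mapping.lookup Z (edge_point G u v t) = 0" by simp
  qed
  with sl[of a] rsl[of b] ab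
  show "of_int (mass Z (edge_point G u v ` {a<..<b})) =
      - slope G f u v a - slope G f v u (edge_len G {u, v} - b)" by simp
next
  fix a b c :: real
  assume abc: "0 \<le> a" "a < b" "b < c" "c \<le> edge_len G {u, v}"
    and ab: "of_int (mass Z (edge_point G u v ` {a<..<b})) =
      - slope G f u v a - slope G f v u (edge_len G {u, v} - b)"
    and bc: "of_int (mass Z (edge_point G u v ` {b<..<c})) =
      - slope G f u v b - slope G f v u (edge_len G {u, v} - c)"
  have "{a<..<c} = ({a<..<b} \<union> {b}) \<union> {b<..<c}"
    using abc by auto
  then have "mass Z (edge_point G u v ` {a<..<c}) = mass Z (edge_point G u v ` {a<..<b}) +
      Poly_Mapping.lookup Z (edge_point G u v b) + mass Z (edge_point G u v ` {b<..<c})"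
    by (simp only: image_Un, subst mass_Un_disjoint, force simp: edge_point_eq_iff[OF uv],
        subst mass_Un_disjoint, force simp: edge_point_eq_iff[OF uv], simp add: mass_singleton)
  with ab bc is_div_interior[OF f(2) uv, of b] abc
  show "of_int (mass Z (edge_point G u v ` {a<..<c})) =
      - slope G f u v a - slope G f v u (edge_len G {u, v} - c)" by simp
qed

lemma mass_open_edge:
  assumes f: "rational_function G f" "is_div G f Z" and uv: "(u, v) \<in> arcs G"
  shows "of_int (mass Z (open_edge G {u, v})) = - slope G f u v 0 - slope G f v u 0"
  unfolding open_edge_eq[OF uv] using mass_open_segment[OF assms, of 0 "edge_len G {u, v}"] arcD[OF uv]
  by simp

lemma mass_half_open_segment:
  assumes f: "rational_function G f" "is_div G f Z" and uv: "(u, v) \<in> arcs G"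
    and y: "0 < y" "y < edge_len G {u, v}"
  shows "of_int (mass Z (edge_point G u v ` {0<..y})) = slope G f u v y - slope G f u v 0"
proof -
  have "{0<..y} = {0<..<y} \<union> {y}"
    using y by auto
  then have "mass Z (edge_point G u v ` {0<..y}) =
      mass Z (edge_point G u v ` {0<..<y}) + Poly_Mapping.lookup Z (edge_point G u v y)"
    by (simp only: image_Un, subst mass_Un_disjoint, force simp: edge_point_eq_iff[OF uv],
        simp add: mass_singleton)
  with mass_open_segment[OF f uv, of 0 y] is_div_interior[OF f(2) uv y] y show ?thesis by simp
qed

subsection \<open>Summation over vertices and edges\<close>

lemma deg_eq_vertices_plus_edges:
  assumes "divisor_on G D"
  shows "deg D = (\<Sum>v\<in>verts G. Poly_Mapping.lookup D (vertex_point v)) +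
                 (\<Sum>e\<in>edges G. mass D (open_edge G e))"
proof -
  let ?supp = "\<lambda>p. {w. p w \<noteq> (0::real)}"
  let ?S = "(\<lambda>v. {v}) ` verts G"
  have fin: "finite ?S" "finite (edges G)" and disj: "?S \<inter> edges G = {}"
    using finite_verts finite_edges card_edge by fastforce+
  have supp: "?supp p \<in> ?S \<union> edges G" if "p \<in> Poly_Mapping.keys D" for p
  proof -
    have "p \<in> points G"
      using assms that by (auto simp: divisor_on_def)
    then show ?thesis
      by (cases rule: points_cases) (simp_all add: support_vertex_point support_edge_point arcD)
  qed
  have *: "mass D (open_edge G e) = (\<Sum>p | p \<in> Poly_Mapping.keys D \<and> ?supp p = e. Poly_Mapping.lookup D p)"
    for e
    using assms unfolding mass_def open_edge_def divisor_on_def by (intro sum.cong) auto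
  have "mass D (open_edge G {v}) = Poly_Mapping.lookup D (vertex_point v)" if "v \<in> verts G" for v
  proof -
    have "open_edge G {v} = {vertex_point v}"
    proof (intro equalityI subsetI)
      fix p assume p: "p \<in> open_edge G {v}"
      then have "p \<in> points G" by (simp add: open_edge_def)
      then show "p \<in> {vertex_point v}"
        using p
        by (cases rule: points_cases)
          (auto simp: open_edge_def support_vertex_point support_edge_point
            doubleton_eq_iff dest: arcD(1))
    qed (use that in \<open>auto simp: open_edge_def vertex_point_in_points support_vertex_point\<close>)
    then show ?thesis by (simp add: mass_singleton)
  qed
  then have "(\<Sum>v\<in>verts G. Poly_Mapping.lookup D (vertex_point v)) = (\<Sum>e\<in>?S. mass D (open_edge G e))"
    by (simp add: sum.reindex)
  also have "\<dots> + (\<Sum>e\<in>edges G. mass D (open_edge G e)) = (\<Sum>e\<in>?S \<union> edges G. mass D (open_edge G e))"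
    using fin disj by (simp add: sum.union_disjoint)
  also have "\<dots> = deg D"
    unfolding * deg_def using fin supp by (intro sum.group) auto
  finally show ?thesis ..
qed

lemma sum_arcs:
  "(\<Sum>v\<in>verts G. \<Sum>w | (v, w) \<in> arcs G. F v w) =
   (\<Sum>e\<in>edges G. \<Sum>(v, w) | (v, w) \<in> arcs G \<and> {v, w} = e. F v w)"
proof -
  have fin: "finite {w. (v, w) \<in> arcs G}" for v
    by (rule finite_subset[of _ "verts G"]) (use finite_verts arcD in auto)
  have "(\<Sum>v\<in>verts G. \<Sum>w | (v, w) \<in> arcs G. F v w) =
      (\<Sum>(v, w)\<in>(SIGMA v:verts G. {w. (v, w) \<in> arcs G}). F v w)"
    using fin finite_verts by (simp add: sum.Sigma)
  also have "(SIGMA v:verts G. {w. (v, w) \<in> arcs G}) = arcs G"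
    using arcD by auto
  also have "(\<Sum>(v, w)\<in>arcs G. F v w) =
      (\<Sum>e\<in>edges G. \<Sum>(v, w)\<in>{a \<in> arcs G. (case a of (v, w) \<Rightarrow> {v, w}) = e}. F v w)"
    using finite_arcs finite_edges arcD by (intro sum.group[symmetric]) auto
  also have "\<dots> = (\<Sum>e\<in>edges G. \<Sum>(v, w) | (v, w) \<in> arcs G \<and> {v, w} = e. F v w)"
    by (intro sum.cong) auto
  finally show ?thesis .
qed

lemma arcs_of_edge:
  assumes "(u, v) \<in> arcs G"
  shows "{(x, y). (x, y) \<in> arcs G \<and> {x, y} = {u, v}} = {(u, v), (v, u)}"
  using assms arc_commute[of u v] by (auto simp: doubleton_eq_iff)

text \<open>The outgoing slopes at the two ends of an edge cancel against the degree on its interior.\<close>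

lemma deg_is_div:
  assumes f: "rational_function G f" "is_div G f Z"
  shows "deg Z = 0"
proof -
  have "of_int (deg Z) = (\<Sum>v\<in>verts G. \<Sum>w | (v, w) \<in> arcs G. slope G f v w 0) +
      (\<Sum>e\<in>edges G. of_int (mass Z (open_edge G e)))"
    using f is_div_vertex[OF f(2)]
    by (simp add: deg_eq_vertices_plus_edges is_div_def)
  also have "\<dots> = (\<Sum>e\<in>edges G. (\<Sum>(v, w) | (v, w) \<in> arcs G \<and> {v, w} = e. slope G f v w 0) +
      of_int (mass Z (open_edge G e)))"
    by (simp add: sum_arcs sum.distrib)
  also have "\<dots> = 0"
  proof (intro sum.neutral ballI)
    fix e assume "e \<in> edges G"
    then obtain u v where "e = {u, v}" "(u, v) \<in> arcs G"
      by (rule edgeE)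
    then show "(\<Sum>(v, w) | (v, w) \<in> arcs G \<and> {v, w} = e. slope G f v w 0) +
        of_int (mass Z (open_edge G e)) = 0"
      using arcD(1)[of u v] by (simp add: arcs_of_edge mass_open_edge[OF f])
  qed
  finally show ?thesis by simp
qed

end

section \<open>Divisors of positive rank have large degree\<close>

context finite_metric_graph
begin

lemma exists_descending_slope:
  assumes f: "rational_function G f" and uv: "(u, v) \<in> arcs G"
    and "f (vertex_point v) < f (vertex_point u) \<or>
         f (vertex_point v) = f (vertex_point u) \<and> 0 < slope G f u v 0"
  shows "\<exists>t. 0 \<le> t \<and> t < edge_len G {u, v} \<and> slope G f u v t \<le> - 1"
proof (rule ccontr)
  assume "\<not> ?thesis"
  then have *: "slope G f u v t > - 1" if "0 \<le> t" "t < edge_len G {u, v}" for t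
    using that by force
  have "f (edge_point G u v 0) \<le> f (edge_point G u v (edge_len G {u, v})) \<and>
      (slope G f u v 0 > 0 \<longrightarrow> f (edge_point G u v 0) < f (edge_point G u v (edge_len G {u, v})))"
    using piecewise_linear_int_mono[OF rational_functionD[OF f uv], of 0 "edge_len G {u, v}"]
      * arcD(5)[OF uv]
    by (simp add: outgoing_slope_def)
  with assms(3) show False
    by (auto simp: edge_point_0[OF uv] edge_point_len[OF uv])
qed

context
  fixes f D E
  assumes f: "rational_function G f" "is_div G f (E - D)"
    and D: "effective D" and E: "effective E"
begin

lemma slopes_le_mass_open_edge:
  assumes "(u, v) \<in> arcs G"
  shows "slope G f u v 0 + slope G f v u 0 \<le> of_int (mass D (open_edge G {u, v}))"
proof -
  have "- mass (E - D) (open_edge G {u, v}) \<le> mass D (open_edge G {u, v})"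
    using mass_nonneg[OF E] by (simp add: mass_diff)
  then have "of_int (- mass (E - D) (open_edge G {u, v})) \<le> (of_int (mass D (open_edge G {u, v})) :: real)"
    by (simp only: of_int_le_iff)
  with mass_open_edge[OF f assms] show ?thesis by simp
qed

text \<open>
  If \<open>f\<close> descends somewhere on its way from \<open>u\<close> to \<open>v\<close>, then the chips of \<open>D\<close> inside the edge
  have to bring the slope of \<open>f\<close> down from its value at \<open>u\<close> to at most \<open>-1\<close>.
\<close>

lemma slope_less_mass_open_edge:
  assumes uv: "(u, v) \<in> arcs G"
    and "f (vertex_point v) < f (vertex_point u) \<or>
         f (vertex_point v) = f (vertex_point u) \<and> 0 < slope G f u v 0"
  shows "slope G f u v 0 + 1 \<le> of_int (mass D (open_edge G {u, v}))"
proof -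
  obtain t where t: "0 \<le> t" "t < edge_len G {u, v}" "slope G f u v t \<le> - 1"
    using exists_descending_slope[OF f(1) uv assms(2)] by blast
  show ?thesis
  proof (cases "t = 0")
    case True
    with t mass_nonneg[OF D, of "open_edge G {u, v}"] show ?thesis by simp
  next
    case False
    let ?I = "edge_point G u v ` {0<..t}"
    have "- mass (E - D) ?I \<le> mass D ?I"
      using mass_nonneg[OF E] by (simp add: mass_diff)
    also have "\<dots> \<le> mass D (open_edge G {u, v})"
      using t unfolding open_edge_eq[OF uv] by (intro mass_mono[OF D] image_mono) auto
    finally have "of_int (- mass (E - D) ?I) \<le> (of_int (mass D (open_edge G {u, v})) :: real)"
      by (simp only: of_int_le_iff)
    with mass_half_open_segment[OF f uv, of t] t False show ?thesis by simp
  qed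
qed

text \<open>
  Effectiveness of \<open>E\<close> forces the chips of \<open>D\<close> at a vertex in \<open>A\<close> to outweigh the outgoing slopes,
  taken with a minus sign. The chips of \<open>D\<close> inside an edge outweigh its slopes at those ends that lie
  in \<open>A\<close>, and exceed them by one if the edge leaves \<open>A\<close>. The slopes cancel in the sum.
\<close>

lemma card_cut_le_deg:
  assumes div: "divisor_on G D"
    and A: "A \<subseteq> verts G" and A_eq: "\<And>v. v \<in> A \<Longrightarrow> f (vertex_point v) = M"
    and A_less: "\<And>v. v \<in> verts G - A \<Longrightarrow> f (vertex_point v) < M"
  shows "int (card (edge_cut G A)) \<le> deg D"
proof -
  let ?s = "\<lambda>v w. if v \<in> A then slope G f v w 0 else 0"
  have fin: "finite (edge_cut G A)"
    using finite_edges by (auto simp: edge_cut_def)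
  have vert: "- (\<Sum>w | (v, w) \<in> arcs G. ?s v w) \<le> of_int (Poly_Mapping.lookup D (vertex_point v))"
    if "v \<in> verts G" for v
  proof (cases "v \<in> A")
    case True
    have "0 \<le> Poly_Mapping.lookup E (vertex_point v)"
      using E by (simp add: effective_def)
    with True is_div_vertex[OF f(2) that] show ?thesis
      by (simp add: lookup_minus)
  next
    case False
    with D show ?thesis by (simp add: effective_def)
  qed
  have edge: "(\<Sum>(v, w) | (v, w) \<in> arcs G \<and> {v, w} = e. ?s v w) + (if e \<in> edge_cut G A then 1 else 0)
      \<le> of_int (mass D (open_edge G e))" if e: "e \<in> edges G" for e
  proof -
    obtain u v where uv: "e = {u, v}" "(u, v) \<in> arcs G"
      using e by (rule edgeE)
    have vu: "(v, u) \<in> arcs G" "{v, u} = {u, v}"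
      using uv arc_commute by auto
    note uv_facts = arcD[OF uv(2)]
    have sum: "(\<Sum>(v, w) | (v, w) \<in> arcs G \<and> {v, w} = e. ?s v w) = ?s u v + ?s v u"
      unfolding uv(1) arcs_of_edge[OF uv(2)] using uv_facts(1) by simp
    consider "u \<in> A" "v \<in> A" | "u \<in> A" "v \<notin> A" | "u \<notin> A" "v \<in> A" | "u \<notin> A" "v \<notin> A"
      by blast
    then show ?thesis
    proof cases
      case 1
      with slopes_le_mass_open_edge[OF uv(2)] show ?thesis
        unfolding sum by (simp add: uv(1) edge_cut_def)
    next
      case 2
      then have "f (vertex_point v) < f (vertex_point u)"
        using A_eq A_less uv_facts by simp
      with 2 slope_less_mass_open_edge[OF uv(2)] show ?thesis
        unfolding sum by (simp add: uv(1) edge_cut_def)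
    next
      case 3
      then have "f (vertex_point u) < f (vertex_point v)"
        using A_eq A_less uv_facts by simp
      with 3 slope_less_mass_open_edge[OF vu(1)] show ?thesis
        unfolding sum vu(2) by (simp add: uv(1) edge_cut_def)
    next
      case 4
      with mass_nonneg[OF D, of "open_edge G e"] show ?thesis
        unfolding sum by (simp add: uv(1) edge_cut_def)
    qed
  qed
  have "real (card (edge_cut G A)) = (\<Sum>e\<in>edges G. if e \<in> edge_cut G A then 1 else 0)"
    using finite_edges by (simp add: sum.If_cases edge_cut_def Int_def conj_ac)
  also have "\<dots> = (\<Sum>v\<in>verts G. - (\<Sum>w | (v, w) \<in> arcs G. ?s v w)) +
      (\<Sum>e\<in>edges G. (\<Sum>(v, w) | (v, w) \<in> arcs G \<and> {v, w} = e. ?s v w) +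
        (if e \<in> edge_cut G A then 1 else 0))"
    unfolding sum_negf sum_arcs sum.distrib by simp
  also have "\<dots> \<le> (\<Sum>v\<in>verts G. of_int (Poly_Mapping.lookup D (vertex_point v))) +
      (\<Sum>e\<in>edges G. of_int (mass D (open_edge G e)))"
    by (intro add_mono sum_mono vert edge)
  also have "\<dots> = of_int (deg D)"
    by (simp add: deg_eq_vertices_plus_edges[OF div])
  finally show ?thesis by simp
qed

lemma constant_on_vertices:
  assumes div: "divisor_on G D"
    and conn: "\<And>A. A \<subseteq> verts G \<Longrightarrow> A \<noteq> {} \<Longrightarrow> A \<noteq> verts G \<Longrightarrow> deg D < int (card (edge_cut G A))"
    and u: "u \<in> verts G" and v: "v \<in> verts G"
  shows "f (vertex_point u) = f (vertex_point v)"
proof -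
  define M where "M = Max ((\<lambda>v. f (vertex_point v)) ` verts G)"
  define A where "A = {v \<in> verts G. f (vertex_point v) = M}"
  have le: "f (vertex_point w) \<le> M" if "w \<in> verts G" for w
    using that finite_verts by (simp add: M_def)
  have "M \<in> (\<lambda>v. f (vertex_point v)) ` verts G"
    unfolding M_def using finite_verts u by (intro Max_in) auto
  then have "A \<noteq> {}"
    by (auto simp: A_def)
  moreover have "int (card (edge_cut G A)) \<le> deg D"
    using le by (intro card_cut_le_deg[OF div, where M = M]) (force simp: A_def)+
  ultimately have "A = verts G"
    using conn[of A] by (force simp: A_def)
  with u v have "u \<in> A" "v \<in> A"
    by simp_all
  then show ?thesis
    by (simp add: A_def)
qed

text \<open>
  If \<open>D\<close> has no chip at \<open>q\<close> but \<open>E\<close> has one, then \<open>f\<close> increases with slope at least \<open>1\<close> along some edge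
  at \<open>q\<close>. As \<open>f\<close> has the same value at the other end, it descends again on that edge.
\<close>

lemma chip_near_vertex:
  assumes "q \<in> verts G" and "0 < Poly_Mapping.lookup E (vertex_point q)"
    and const: "\<And>u v. u \<in> verts G \<Longrightarrow> v \<in> verts G \<Longrightarrow> f (vertex_point u) = f (vertex_point v)"
    and "Poly_Mapping.lookup D (vertex_point q) = 0"
  shows "\<exists>e\<in>edges G. q \<in> e \<and> 2 \<le> mass D (open_edge G e)"
proof -
  have "0 < (\<Sum>w | (q, w) \<in> arcs G. slope G f q w 0)"
    using is_div_vertex[OF f(2) assms(1)] assms(2,4) by (simp add: lookup_minus)
  then obtain w where w: "(q, w) \<in> arcs G" "0 < slope G f q w 0"
    by (metis (mono_tags, lifting) mem_Collect_eq not_le sum_nonpos)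
  have "slope G f q w 0 + 1 \<le> of_int (mass D (open_edge G {q, w}))"
    using w const[of w q] arcD[OF w(1)] by (intro slope_less_mass_open_edge) auto
  then have "1 < (of_int (mass D (open_edge G {q, w})) :: real)"
    using w(2) by linarith
  then have "2 \<le> mass D (open_edge G {q, w})"
    by linarith
  with arcD[OF w(1)] show ?thesis by blast
qed

end

text \<open>
  Each vertex has a chip of its own: one sitting on it, or one of the chips inside an edge, where
  two chips serve the two ends.
\<close>

lemma card_verts_le_deg:
  assumes div: "divisor_on G D" and D: "effective D"
    and near: "\<And>q. q \<in> verts G \<Longrightarrow> Poly_Mapping.lookup D (vertex_point q) = 0 \<Longrightarrow>
      \<exists>e\<in>edges G. q \<in> e \<and> 2 \<le> mass D (open_edge G e)"
  shows "int (card (verts G)) \<le> deg D"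
proof -
  define Q where "Q = {e \<in> edges G. 2 \<le> mass D (open_edge G e)}"
  define U where "U = {q \<in> verts G. Poly_Mapping.lookup D (vertex_point q) = 0}"
  have fin: "finite Q" "finite U" "finite (verts G)"
    using finite_edges finite_verts by (auto simp: Q_def U_def)
  have "card U \<le> card (\<Union>Q)"
    using near fin card_edge by (intro card_mono) (auto simp: U_def Q_def card_ge_0_finite)
  also have "\<dots> \<le> (\<Sum>e\<in>Q. card e)"
    by (rule card_Union_le_sum_card)
  also have "\<dots> = (\<Sum>e\<in>Q. 2)"
    using card_edge by (intro sum.cong) (auto simp: Q_def)
  finally have "int (card U) \<le> (\<Sum>e\<in>Q. 2)"
    by simp
  also have "\<dots> \<le> (\<Sum>e\<in>Q. mass D (open_edge G e))"
    by (intro sum_mono) (auto simp: Q_def)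
  also have "\<dots> \<le> (\<Sum>e\<in>edges G. mass D (open_edge G e))"
    using mass_nonneg[OF D] finite_edges by (intro sum_mono2) (auto simp: Q_def)
  finally have U: "int (card U) \<le> (\<Sum>e\<in>edges G. mass D (open_edge G e))" .
  have "int (card (verts G - U)) = (\<Sum>v\<in>verts G - U. 1)"
    by simp
  also have "\<dots> \<le> (\<Sum>v\<in>verts G - U. Poly_Mapping.lookup D (vertex_point v))"
    using D by (intro sum_mono) (auto simp: U_def effective_def int_one_le_iff_zero_less order_less_le)
  also have "\<dots> \<le> (\<Sum>v\<in>verts G. Poly_Mapping.lookup D (vertex_point v))"
    using D fin by (intro sum_mono2) (auto simp: effective_def)
  finally have "int (card (verts G - U)) \<le> (\<Sum>v\<in>verts G. Poly_Mapping.lookup D (vertex_point v))" .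
  moreover have "card (verts G) = card U + card (verts G - U)"
    using fin card_Un_disjoint[of U "verts G - U"] by (auto simp: U_def Un_absorb1)
  ultimately show ?thesis
    using U by (simp add: deg_eq_vertices_plus_edges[OF div])
qed

end

subsection \<open>From the rank to the gonality\<close>

text \<open>
  If \<open>D\<close> has a nonempty linear system, then its rank is the largest \<open>r\<close> with this property; on a
  graph with at least one vertex, the property for \<open>r = 1\<close> already means positive rank.
\<close>

definition rank_at_least :: "'v weighted_graph \<Rightarrow> 'v divisor \<Rightarrow> nat \<Rightarrow> bool" where
  "rank_at_least G D r \<longleftrightarrow>
     (\<forall>E. divisor_on G E \<and> effective E \<and> deg E = int r \<longrightarrow> linear_system G (D - E) \<noteq> {})"

context finite_metric_graph
begin

lemma rank_at_least_1_imp_reach: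
  assumes "divisor_on G D" and "rank_at_least G D 1" and p: "p \<in> points G"
  obtains E f where "divisor_on G E" and "effective E" and "0 < Poly_Mapping.lookup E p"
    and "rational_function G f" and "is_div G f (E - D)"
proof -
  let ?p = "Poly_Mapping.single p (1::int)"
  have "linear_system G (D - ?p) \<noteq> {}"
    using assms p by (simp add: rank_at_least_def divisor_on_single effective_single deg_single)
  then obtain E f where E: "divisor_on G E" "effective E"
    and f: "rational_function G f" "is_div G f (E - (D - ?p))"
    unfolding linear_system_def lin_equiv_def by blast
  have "E - (D - ?p) = (E + ?p) - D"
    by simp
  moreover have "0 < Poly_Mapping.lookup (E + ?p) p"
    using E(2) by (simp add: lookup_add effective_def add_nonneg_pos)
  ultimately show thesis
    using that[of "E + ?p" f] E f p
    by (metis divisor_on_add divisor_on_single effective_add effective_single zero_le_one)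
qed

text \<open>
  Positive rank forces the degree to be at least the number of vertices or the edge connectivity,
  whichever is smaller.
\<close>

lemma rank_at_least_1_imp_deg_ge:
  assumes D: "divisor_on G D" "rank_at_least G D 1" and "verts G \<noteq> {}"
    and conn: "\<And>A. A \<subseteq> verts G \<Longrightarrow> A \<noteq> {} \<Longrightarrow> A \<noteq> verts G \<Longrightarrow> k \<le> card (edge_cut G A)"
    and "k \<le> card (verts G)"
  shows "int k \<le> deg D"
proof (rule ccontr)
  assume less: "\<not> int k \<le> deg D"
  obtain q0 where "q0 \<in> verts G"
    using assms(3) by blast
  then obtain D' f' where D': "divisor_on G D'" "effective D'"
    and f': "rational_function G f'" "is_div G f' (D' - D)"
    using rank_at_least_1_imp_reach[OF D vertex_point_in_points] by metis
  have "deg D' = deg D"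
    using deg_is_div[OF f'] by (simp add: deg_diff)
  have conn': "deg D' < int (card (edge_cut G A))"
    if "A \<subseteq> verts G" "A \<noteq> {}" "A \<noteq> verts G" for A
    using conn[OF that] less \<open>deg D' = deg D\<close> by linarith
  have "\<exists>e\<in>edges G. q \<in> e \<and> 2 \<le> mass D' (open_edge G e)"
    if q: "q \<in> verts G" and q0: "Poly_Mapping.lookup D' (vertex_point q) = 0" for q
  proof -
    obtain E f where E: "effective E" "0 < Poly_Mapping.lookup E (vertex_point q)"
      and f: "rational_function G f" "is_div G f (E - D)"
      using rank_at_least_1_imp_reach[OF D vertex_point_in_points[OF q]] by metis
    \<comment> \<open>\<open>E\<close> and \<open>D'\<close> are both given relative to \<open>D\<close>, so the functions have to be subtracted.\<close>
    have "is_div G (\<lambda>p. f p - f' p) ((E - D) - (D' - D))"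
      by (rule is_div_diff[OF f f'])
    moreover have "(E - D) - (D' - D) = E - D'"
      by simp
    ultimately have g: "rational_function G (\<lambda>p. f p - f' p)" "is_div G (\<lambda>p. f p - f' p) (E - D')"
      using rational_function_diff[OF f(1) f'(1)] by auto
    show ?thesis
      by (rule chip_near_vertex[OF g D'(2) E(1) q E(2) constant_on_vertices[OF g D'(2) E(1) D'(1)] q0])
        (use conn' in auto)
  qed
  then have "int (card (verts G)) \<le> deg D'"
    by (rule card_verts_le_deg[OF D'])
  with less assms(5) \<open>deg D' = deg D\<close> show False by simp
qed

lemma rank_at_least_imp_rank_at_least_1:
  assumes "rank_at_least G D r" and "1 \<le> r" and p: "p \<in> points G"
  shows "rank_at_least G (D - Poly_Mapping.single p (int (r - 1))) 1"
  unfolding rank_at_least_def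
proof (intro allI impI, elim conjE)
  let ?P = "Poly_Mapping.single p (int (r - 1))"
  fix E :: "'v divisor"
  assume E: "divisor_on G E" "effective E" "deg E = int 1"
  have "linear_system G (D - (?P + E)) \<noteq> {}"
    using assms(1)[unfolded rank_at_least_def, rule_format, of "?P + E"] E assms(2) p
    by (simp add: divisor_on_add divisor_on_single effective_add effective_single deg_add deg_single)
  then show "linear_system G (D - ?P - E) \<noteq> {}"
    by (simp add: diff_diff_eq)
qed

text \<open>
  If positive rank forces degree at least \<open>k\<close>, then rank at least \<open>r\<close> forces degree at least
  \<open>k + r - 1\<close>. Hence a divisor of degree \<open>k\<close> and positive rank has rank exactly \<open>1\<close>.
\<close>

lemma gonality_eqI:
  assumes "verts G \<noteq> {}"
    and lower: "\<And>D. divisor_on G D \<Longrightarrow> rank_at_least G D 1 \<Longrightarrow> k \<le> deg D"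
    and D: "divisor_on G D" "rank_at_least G D 1" "deg D = k"
  shows "gonality G = k"
proof -
  obtain p where p: "p \<in> points G"
    using assms(1) vertex_point_in_points by blast
  have bound: "int r \<le> deg D - k + 1" if "divisor_on G D" "rank_at_least G D r" "1 \<le> r" for D r
    using lower[OF _ rank_at_least_imp_rank_at_least_1[OF that(2,3) p]] that p
    by (simp add: deg_diff deg_single divisor_on_diff divisor_on_single)
  have rank: "divisor_rank G D = (if linear_system G D = {} then - 1
      else int (GREATEST r. rank_at_least G D r))" for D
    by (simp add: divisor_rank_def rank_at_least_def)
  have rank_0: "rank_at_least G D 0" if "linear_system G D \<noteq> {}" for D
    unfolding rank_at_least_def
  proof (intro allI impI, elim conjE)
    fix E :: "'v divisor" assume E: "effective E" "deg E = int 0"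
    have "Poly_Mapping.lookup E p = 0" for p
      using lookup_le_deg[OF E(1), of p] E by (simp add: effective_def antisym)
    then have "E = 0"
      by (intro poly_mapping_eqI) simp
    with that show "linear_system G (D - E) \<noteq> {}" by simp
  qed
  have ge: "k \<le> deg D" if "divisor_on G D" "divisor_rank G D = 1" for D
  proof -
    have ne: "linear_system G D \<noteq> {}" and G1: "(GREATEST r. rank_at_least G D r) = 1"
      using that(2) unfolding rank by (auto split: if_splits)
    have "r \<le> nat (deg D - k + 1)" if "rank_at_least G D r" for r
      using bound[OF \<open>divisor_on G D\<close> that] by (cases "r = 0") simp_all
    then have "rank_at_least G D (GREATEST r. rank_at_least G D r)"
      by (rule GreatestI_nat[where P = "rank_at_least G D", OF rank_0[OF ne]])
    with G1 lower that(1) show ?thesis by simp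
  qed
  have "divisor_rank G D = 1"
  proof -
    obtain E f where E: "divisor_on G E" "effective E"
      and f: "rational_function G f" "is_div G f (E - D)"
      using rank_at_least_1_imp_reach[OF D(1,2) p] by metis
    then have "linear_system G D \<noteq> {}"
      unfolding linear_system_def lin_equiv_def by blast
    moreover have "(GREATEST r. rank_at_least G D r) = 1"
    proof (rule Greatest_equality)
      fix r assume "rank_at_least G D r"
      with bound[OF D(1), of r] D(3) show "r \<le> 1" by (cases "r = 0") auto
    qed (fact D(2))
    ultimately show ?thesis by (simp add: rank)
  qed
  with D ge show ?thesis
    unfolding gonality_def by (intro Least_equality) auto
qed

end

section \<open>Moving chips along edges\<close>

lemma piecewise_linear_intI:
  assumes "finite S"
    and "\<And>a b. 0 \<le> a \<Longrightarrow> a < b \<Longrightarrow> b \<le> L \<Longrightarrow> (\<And>x. x \<in> S \<Longrightarrow> x \<le> a \<or> b \<le> x) \<Longrightarrow>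
      \<exists>m::int. \<forall>s. a \<le> s \<and> s \<le> b \<longrightarrow> g s = g a + of_int m * (s - a)"
  shows "piecewise_linear_int L g"
  unfolding piecewise_linear_int_def
proof (intro exI[of _ S] conjI allI impI)
  fix a b assume ab: "0 \<le> a \<and> a < b \<and> b \<le> L \<and> {a<..<b} \<inter> S = {}"
  then have "x \<le> a \<or> b \<le> x" if "x \<in> S" for x
    using that by force
  with ab assms(2)[of a b] obtain m :: int
    where m: "\<forall>s. a \<le> s \<and> s \<le> b \<longrightarrow> g s = g a + of_int m * (s - a)" by blast
  show "\<exists>m::int. \<forall>s\<in>{a..b}. g s = g a + of_int m * (s - a)"
    by (intro exI[of _ m] ballI m[rule_format]) simp
qed (fact assms(1))

lemma piecewise_linear_int_reverse:
  assumes "piecewise_linear_int L g"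
  shows "piecewise_linear_int L (\<lambda>s. g (L - s))"
proof -
  obtain S where S: "finite S"
    and aff: "\<And>a b. 0 \<le> a \<and> a < b \<and> b \<le> L \<and> {a<..<b} \<inter> S = {} \<Longrightarrow>
                \<exists>m::int. \<forall>s\<in>{a..b}. g s = g a + of_int m * (s - a)"
    using assms unfolding piecewise_linear_int_def by blast
  show ?thesis
  proof (rule piecewise_linear_intI)
    fix a b assume ab: "0 \<le> a" "a < b" "b \<le> L"
      and avoid: "\<And>x. x \<in> (\<lambda>s. L - s) ` S \<Longrightarrow> x \<le> a \<or> b \<le> x"
    have "{L - b<..<L - a} \<inter> S = {}"
      using avoid by fastforce
    with ab aff[of "L - b" "L - a"] obtain m :: int
      where m: "\<forall>s\<in>{L - b..L - a}. g s = g (L - b) + of_int m * (s - (L - b))" by auto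
    have "g (L - s) = g (L - a) + of_int (- m) * (s - a)" if "a \<le> s" "s \<le> b" for s
      using m[rule_format, of "L - s"] m[rule_format, of "L - a"] that ab
      by (simp add: algebra_simps)
    then show "\<exists>m::int. \<forall>s. a \<le> s \<and> s \<le> b \<longrightarrow> g (L - s) = g (L - a) + of_int m * (s - a)"
      by blast
  qed (use S in simp)
qed

lemma continuous_on_coordinate: "continuous_on S (\<lambda>p. p i)"
  by (rule continuous_on_subset[OF continuous_on_product_coordinates]) simp

context finite_metric_graph
begin

text \<open>To describe a rational function and its divisor, one orientation of each edge suffices.\<close>

lemma rational_functionI:
  assumes "continuous_on (points G) f"
    and "\<And>u v. (u, v) \<in> arcs G \<Longrightarrow>
      piecewise_linear_int (edge_len G {u, v}) (\<lambda>s. f (edge_point G u v s)) \<or>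
      piecewise_linear_int (edge_len G {u, v}) (\<lambda>s. f (edge_point G v u s))"
  shows "rational_function G f"
proof -
  have "piecewise_linear_int (edge_len G {u, v}) (\<lambda>s. f (edge_point G u v s))"
    if uv: "(u, v) \<in> arcs G" for u v
    using assms(2)[OF uv]
  proof
    assume "piecewise_linear_int (edge_len G {u, v}) (\<lambda>s. f (edge_point G v u s))"
    then have "piecewise_linear_int (edge_len G {u, v})
        (\<lambda>s. f (edge_point G v u (edge_len G {u, v} - s)))"
      by (rule piecewise_linear_int_reverse)
    then show ?thesis
      by (simp add: edge_point_reverse[OF uv])
  qed
  with assms(1) show ?thesis
    unfolding rational_function_def by blast
qed

lemma is_divI_one_orientation:
  assumes "divisor_on G Z"
    and "\<And>v. v \<in> verts G \<Longrightarrow>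
      of_int (Poly_Mapping.lookup Z (vertex_point v)) = (\<Sum>w | (v, w) \<in> arcs G. slope G f v w 0)"
    and "\<And>u v. (u, v) \<in> arcs G \<Longrightarrow> \<exists>x y. {x, y} = {u, v} \<and>
      (\<forall>t. 0 < t \<and> t < edge_len G {u, v} \<longrightarrow>
        of_int (Poly_Mapping.lookup Z (edge_point G x y t)) =
        slope G f x y t + slope G f y x (edge_len G {u, v} - t))"
  shows "is_div G f Z"
proof (rule is_divI[OF assms(1,2)])
  fix u v t assume uv: "(u, v) \<in> arcs G" and t: "0 < t" "t < edge_len G {u, v}"
  obtain x y where xy: "{x, y} = {u, v}"
    and eq: "\<And>t. 0 < t \<and> t < edge_len G {u, v} \<Longrightarrow>
        of_int (Poly_Mapping.lookup Z (edge_point G x y t)) =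
        slope G f x y t + slope G f y x (edge_len G {u, v} - t)"
    using assms(3)[OF uv] by blast
  from xy consider "x = u" "y = v" | "x = v" "y = u"
    by (auto simp: doubleton_eq_iff)
  then show "of_int (Poly_Mapping.lookup Z (edge_point G u v t)) =
      slope G f u v t + slope G f v u (edge_len G {u, v} - t)"
  proof cases
    case 1
    with eq[of t] t show ?thesis by simp
  next
    case 2
    with eq[of "edge_len G {u, v} - t"] t show ?thesis
      by (simp add: edge_point_reverse[OF uv])
  qed
qed

lemma slope_eq_0:
  assumes "(u, v) \<in> arcs G" and "0 \<le> t" and "t < edge_len G {u, v}"
    and "\<And>s. 0 \<le> s \<Longrightarrow> s \<le> edge_len G {u, v} \<Longrightarrow> f (edge_point G u v s) = 0"
  shows "slope G f u v t = 0"
  using assms(2,3) by (rule slope_affine) (use assms(4) arcD(5)[OF assms(1)] in simp)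

lemma rational_function_zero: "rational_function G (\<lambda>p. 0)"
  by (auto intro!: rational_functionI piecewise_linear_intI[of "{}"] exI[of _ "0::int"])

lemma is_div_zero: "is_div G (\<lambda>p. 0) 0"
proof -
  have "vector_derivative (\<lambda>s. 0 :: real) (at_right t) = 0" for t :: real
    by (rule vector_derivative_right_affine[where b = "t + 1"]) simp_all
  then show ?thesis
    by (simp add: is_div_def outgoing_slope_def divisor_on_def split_def)
qed

lemma lin_equiv_sym:
  assumes "lin_equiv G D E"
  shows "lin_equiv G E D"
proof -
  obtain f where f: "rational_function G f" "is_div G f (D - E)"
    using assms unfolding lin_equiv_def by blast
  note zero = rational_function_zero is_div_zero
  have "is_div G (\<lambda>p. 0 - f p) (0 - (D - E))"
    by (rule is_div_diff[OF zero f])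
  then have "is_div G (\<lambda>p. 0 - f p) (E - D)"
    by simp
  with rational_function_diff[OF zero(1) f(1)] show ?thesis
    unfolding lin_equiv_def by blast
qed

lemma lin_equiv_trans:
  assumes "lin_equiv G D1 D2" and "lin_equiv G D2 D3"
  shows "lin_equiv G D1 D3"
proof -
  obtain f where f: "rational_function G f" "is_div G f (D1 - D2)"
    using assms(1) unfolding lin_equiv_def by blast
  obtain g where g: "rational_function G g" "is_div G g (D3 - D2)"
    using lin_equiv_sym[OF assms(2)] unfolding lin_equiv_def by blast
  have "(D1 - D2) - (D3 - D2) = D1 - D3"
    by simp
  then have "is_div G (\<lambda>p. f p - g p) (D1 - D3)"
    using is_div_diff[OF f g] by simp
  with rational_function_diff[OF f(1) g(1)] show ?thesis
    unfolding lin_equiv_def by blast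
qed

lemma lin_equiv_refl: "lin_equiv G D D"
  using rational_function_zero is_div_zero unfolding lin_equiv_def by fastforce

subsection \<open>Two chips on an edge move towards each other\<close>

text \<open>
  Chips at distance \<open>m\<close> from \<open>u\<close> on the edge \<open>{u, v}\<close> and at \<open>v\<close> can both move by \<open>c\<close> towards each
  other. The function is zero outside that edge, and along it the trapezoid of height \<open>c\<close> over the
  segment between the two chips.
\<close>

lemma lin_equiv_move_pair:
  assumes uv: "(u, v) \<in> arcs G" and m: "0 \<le> m" and c: "0 < c" and mc: "m + 2 * c \<le> edge_len G {u, v}"
  shows "lin_equiv G
    (Poly_Mapping.single (edge_point G u v m) 1 + Poly_Mapping.single (vertex_point v) 1)
    (Poly_Mapping.single (edge_point G u v (m + c)) 1 +
     Poly_Mapping.single (edge_point G u v (edge_len G {u, v} - c)) 1)"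
proof -
  define L where "L = edge_len G {u, v}"
  define f where "f p = max 0 (min c (min (L * p v - m) (L * p u)))" for p :: "'v \<Rightarrow> real"
  let ?D = "Poly_Mapping.single (edge_point G u v m) (1::int) + Poly_Mapping.single (vertex_point v) 1"
  let ?E = "Poly_Mapping.single (edge_point G u v (m + c)) (1::int) +
      Poly_Mapping.single (edge_point G u v (L - c)) 1"
  note uv_facts = arcD[OF uv]
  have mc': "m + 2 * c \<le> L" and L: "0 < L" "edge_len G {v, u} = L"
    using mc uv_facts by (simp_all add: L_def insert_commute)
  have f_uv: "f (edge_point G u v s) = max 0 (min c (min (s - m) (L - s)))" for s
  proof -
    have "L * edge_point G u v s v = s" "L * edge_point G u v s u = L - s"
      using uv_facts by (simp_all add: edge_point_def L_def right_diff_distrib)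
    then show ?thesis by (simp add: f_def)
  qed
  have f_other: "f (edge_point G x y s) = 0" if "{x, y} \<noteq> {u, v}" "(x, y) \<in> arcs G" for x y s
  proof -
    have "edge_point G x y s u = 0 \<or> edge_point G x y s v = 0"
      using that uv_facts(1) arcD(1)[OF that(2)] by (auto simp: edge_point_def)
    then show ?thesis
      using m c by (auto simp: f_def)
  qed
  have pl: "piecewise_linear_int L (\<lambda>s. f (edge_point G u v s))"
    unfolding f_uv
  proof (rule piecewise_linear_intI[of "{m, m + c, L - c}"])
    fix a b assume ab: "0 \<le> a" "a < b" "b \<le> L"
      and "\<And>x. x \<in> {m, m + c, L - c} \<Longrightarrow> x \<le> a \<or> b \<le> x"
    then have "m \<le> a \<or> b \<le> m" "m + c \<le> a \<or> b \<le> m + c" "L - c \<le> a \<or> b \<le> L - c"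
      by simp_all
    then consider "b \<le> m" | "m \<le> a" "b \<le> m + c" | "m + c \<le> a" "b \<le> L - c" | "L - c \<le> a"
      by linarith
    then show "\<exists>k::int. \<forall>s. a \<le> s \<and> s \<le> b \<longrightarrow>
        max 0 (min c (min (s - m) (L - s))) = max 0 (min c (min (a - m) (L - a))) + of_int k * (s - a)"
    proof cases
      case 1
      with mc' c ab show ?thesis by (intro exI[of _ 0]) (auto simp: max_def min_def)
    next
      case 2
      with mc' c ab show ?thesis by (intro exI[of _ 1]) (auto simp: max_def min_def)
    next
      case 3
      with mc' c ab show ?thesis by (intro exI[of _ 0]) (auto simp: max_def min_def)
    next
      case 4
      with mc' c ab show ?thesis by (intro exI[of _ "-1"]) (auto simp: max_def min_def)
    qed
  qed simp
  have rat: "rational_function G f"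
  proof (rule rational_functionI)
    show "continuous_on (points G) f"
      unfolding f_def by (intro continuous_intros continuous_on_coordinate)
    fix x y assume xy: "(x, y) \<in> arcs G"
    show "piecewise_linear_int (edge_len G {x, y}) (\<lambda>s. f (edge_point G x y s)) \<or>
        piecewise_linear_int (edge_len G {x, y}) (\<lambda>s. f (edge_point G y x s))"
    proof (cases "{x, y} = {u, v}")
      case True
      with pl show ?thesis
        by (auto simp: doubleton_eq_iff L_def insert_commute)
    next
      case False
      with xy show ?thesis
        by (auto simp: f_other intro!: piecewise_linear_intI[of "{}"] exI[of _ "0::int"])
    qed
  qed
  have slope_uv: "slope G f u v t =
      (if t < m then 0 else if t < m + c then 1 else if t < L - c then 0 else -1)"
    if t: "0 \<le> t" "t < L" for t
  proof -
    consider "t < m" | "m \<le> t" "t < m + c" | "m + c \<le> t" "t < L - c" | "L - c \<le> t"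
      by linarith
    then show ?thesis
    proof cases
      case 1
      have "slope G f u v t = 0"
        using order_refl 1 by (rule slope_affine) (use mc' c 1 in \<open>auto simp: f_uv\<close>)
      with 1 show ?thesis by simp
    next
      case 2
      have "slope G f u v t = 1"
        using order_refl 2(2) by (rule slope_affine) (use mc' c 2 in \<open>auto simp: f_uv\<close>)
      with 2 show ?thesis by simp
    next
      case 3
      have "slope G f u v t = 0"
        using order_refl 3(2) by (rule slope_affine) (use mc' c 3 in \<open>auto simp: f_uv\<close>)
      with 3 c show ?thesis by simp
    next
      case 4
      have "slope G f u v t = - 1"
        using order_refl t(2) by (rule slope_affine) (use mc' c 4 in \<open>auto simp: f_uv\<close>)
      with 4 c mc' show ?thesis by simp
    qed
  qed
  have slope_vu: "slope G f v u (L - t) =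
      (if t \<le> m then 0 else if t \<le> m + c then -1 else if t \<le> L - c then 0 else 1)"
    if t: "0 < t" "t \<le> L" for t
  proof -
    note rev = slope_reverse_affine[OF uv, of _ t t, folded L_def, OF _ order_refl]
    consider "t \<le> m" | "m < t" "t \<le> m + c" | "m + c < t" "t \<le> L - c" | "L - c < t"
      by linarith
    then show ?thesis
    proof cases
      case 1
      have "slope G f v u (L - t) = - 0"
        using t(1) by (rule rev) (use mc' c 1 t in \<open>auto simp: f_uv\<close>)
      with 1 show ?thesis by simp
    next
      case 2
      have "slope G f v u (L - t) = - 1"
        using 2(1) by (rule rev) (use mc' c 2 t in \<open>auto simp: f_uv\<close>)
      with 2 show ?thesis by simp
    next
      case 3
      have "slope G f v u (L - t) = - 0"
        using 3(1) by (rule rev) (use mc' c 3 t in \<open>auto simp: f_uv\<close>)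
      with 3 c show ?thesis by simp
    next
      case 4
      have "slope G f v u (L - t) = - (- 1)"
        using 4(1) by (rule rev) (use mc' c 4 t in \<open>auto simp: f_uv\<close>)
      with 4 c mc' show ?thesis by simp
    qed
  qed
  have slope_other: "slope G f x y t = 0"
    if "(x, y) \<in> arcs G" "{x, y} \<noteq> {u, v}" "0 \<le> t" "t < edge_len G {x, y}" for x y t
    using that by (intro slope_eq_0) (simp_all add: f_other)
  have "is_div G f (?D - ?E)"
  proof (rule is_divI_one_orientation)
    show "divisor_on G (?D - ?E)"
      using uv m c mc' uv_facts
      by (intro divisor_on_diff divisor_on_add divisor_on_single vertex_point_in_points
          edge_point_in_points) (simp_all add: L_def)
  next
    fix x assume x: "x \<in> verts G"
    have fin: "finite {w. (x, w) \<in> arcs G}"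
      by (rule finite_subset[of _ "verts G"]) (use finite_verts arcD in auto)
    have ne: "edge_point G u v s \<noteq> vertex_point x" if "0 < s" "s < L" for s
      using support_edge_point[OF uv, of s] support_vertex_point[of x] that uv_facts(1)
      by (metis L_def doubleton_eq_iff insert_absorb2)
    have 1: "edge_point G u v (m + c) \<noteq> vertex_point x" "edge_point G u v (L - c) \<noteq> vertex_point x"
      using ne[of "m + c"] ne[of "L - c"] m c mc' by simp_all
    have 2: "edge_point G u v m = vertex_point x \<longleftrightarrow> m = 0 \<and> x = u"
      using ne[of m] m c mc' edge_point_0[OF uv] by (cases "m = 0") (auto simp: vertex_point_eq_iff)
    have only: "(\<Sum>w | (x, w) \<in> arcs G. slope G f x w 0) = slope G f x y 0"
      if "(x, y) \<in> arcs G" "{x, y} = {u, v}" for y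
    proof -
      have "(\<Sum>w | (x, w) \<in> arcs G. slope G f x w 0) =
          (\<Sum>w | (x, w) \<in> arcs G. if w = y then slope G f x y 0 else 0)"
        using that by (intro sum.cong) (auto simp: slope_other arcD doubleton_eq_iff)
      with fin that show ?thesis by simp
    qed
    have "(\<Sum>w | (x, w) \<in> arcs G. slope G f x w 0) =
        (if x = u then slope G f u v 0 else 0) + (if x = v then slope G f v u 0 else 0)"
    proof (cases "x = u \<or> x = v")
      case True
      with only[of v] only[of u] uv arc_commute[of u v] uv_facts(1) show ?thesis
        by (auto simp: insert_commute)
    next
      case False
      then show ?thesis
        by (auto intro!: sum.neutral simp: slope_other arcD doubleton_eq_iff)
    qed
    moreover have "slope G f u v 0 = (if m = 0 then 1 else 0)"
      using slope_uv[of 0] L(1) m c by simp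
    moreover have "slope G f v u 0 = 1"
      using slope_vu[of L] L(1) m c mc' by simp
    moreover have "Poly_Mapping.lookup (?D - ?E) (vertex_point x) =
        (if m = 0 \<and> x = u then 1 else 0) + (if x = v then 1 else 0)"
      unfolding lookup_minus lookup_add lookup_single 2 vertex_point_eq_iff
      using 1 by (simp add: when_def)
    ultimately show "of_int (Poly_Mapping.lookup (?D - ?E) (vertex_point x)) =
        (\<Sum>w | (x, w) \<in> arcs G. slope G f x w 0)"
      using uv_facts(1) by simp
  next
    fix x y assume xy: "(x, y) \<in> arcs G"
    show "\<exists>a b. {a, b} = {x, y} \<and> (\<forall>t. 0 < t \<and> t < edge_len G {x, y} \<longrightarrow>
        of_int (Poly_Mapping.lookup (?D - ?E) (edge_point G a b t)) =
        slope G f a b t + slope G f b a (edge_len G {x, y} - t))"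
    proof (cases "{x, y} = {u, v}")
      case True
      have "of_int (Poly_Mapping.lookup (?D - ?E) (edge_point G u v t)) =
          slope G f u v t + slope G f v u (L - t)" if t: "0 < t" "t < L" for t
      proof -
        have "vertex_point v \<noteq> edge_point G u v t"
          using t edge_point_eq_iff[OF uv, of L t] edge_point_len[OF uv] by (simp add: L_def)
        then have "of_int (Poly_Mapping.lookup (?D - ?E) (edge_point G u v t)) =
            (if m = t then 1 else 0) - (if m + c = t then 1 else 0) - (if L - c = t then 1 else (0::real))"
          unfolding lookup_minus lookup_add lookup_single edge_point_eq_iff[OF uv]
          by (simp add: when_def)
        moreover have "slope G f u v t =
            (if t < m then 0 else if t < m + c then 1 else if t < L - c then 0 else -1)"
          using t by (intro slope_uv) simp_all
        moreover have "slope G f v u (L - t) =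
            (if t \<le> m then 0 else if t \<le> m + c then -1 else if t \<le> L - c then 0 else 1)"
          using t by (intro slope_vu) simp_all
        moreover consider "t < m" | "t = m" | "m < t" "t < m + c" | "t = m + c" "t < L - c"
          | "t = m + c" "t = L - c" | "m + c < t" "t < L - c" | "m + c < t" "t = L - c" | "L - c < t"
          using mc' by linarith
        ultimately show ?thesis
          using c mc' by cases simp_all
      qed
      with True show ?thesis
        by (intro exI[of _ u] exI[of _ v]) (simp add: L_def)
    next
      case False
      have "of_int (Poly_Mapping.lookup (?D - ?E) (edge_point G x y t)) =
          slope G f x y t + slope G f y x (edge_len G {x, y} - t)"
        if t: "0 < t" "t < edge_len G {x, y}" for t
      proof -
        have "slope G f x y t + slope G f y x (edge_len G {x, y} - t) = 0"
          using t xy arc_commute[of x y] False by (simp add: slope_other insert_commute)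
        moreover have ne: "edge_point G u v s \<noteq> edge_point G x y t" if "0 \<le> s" "s \<le> L" for s
        proof
          assume eq: "edge_point G u v s = edge_point G x y t"
          have "{w. edge_point G u v s w \<noteq> 0} \<subseteq> {u, v}"
            by (auto simp: edge_point_def)
          then have "{x, y} \<subseteq> {u, v}"
            using support_edge_point[OF xy t] eq by simp
          with arcD(1)[OF xy] False show False by auto
        qed
        moreover have "vertex_point v \<noteq> edge_point G x y t"
          using ne[of L] L(1) edge_point_len[OF uv] by (simp add: L_def)
        moreover have "edge_point G u v m \<noteq> edge_point G x y t"
          "edge_point G u v (m + c) \<noteq> edge_point G x y t"
          "edge_point G u v (L - c) \<noteq> edge_point G x y t"
          using m c mc' by (simp_all add: ne)
        ultimately show ?thesis
          unfolding lookup_minus lookup_add lookup_single by simp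
      qed
      then show ?thesis by blast
    qed
  qed
  with rat show ?thesis
    unfolding lin_equiv_def L_def by blast
qed

end

context finite_metric_graph
begin

subsection \<open>All neighbours of a vertex move a chip towards it\<close>

text \<open>
  The function is zero outside the star of \<open>x\<close>, and on an edge of that star it is the distance
  from the far end, cut off at \<open>c\<close>. The formula below writes it in barycentric coordinates: on the
  edge \<open>{v, x}\<close> only the summand for \<open>w = v\<close> is nonzero, because \<open>c\<close> is at most the length of every
  edge at \<open>x\<close>, and on an edge away from \<open>x\<close> the coordinate of \<open>x\<close> vanishes.
\<close>

lemma lin_equiv_fire_towards:
  assumes c: "0 < c" and cL: "\<And>v. (v, x) \<in> arcs G \<Longrightarrow> c \<le> edge_len G {v, x}"
  shows "lin_equiv G (\<Sum>v | (v, x) \<in> arcs G. Poly_Mapping.single (vertex_point v) 1)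
    (\<Sum>v | (v, x) \<in> arcs G. Poly_Mapping.single (edge_point G v x c) 1)"
proof -
  define N where "N = {v. (v, x) \<in> arcs G}"
  define L where "L v = edge_len G {v, x}" for v
  define f where "f p = max 0 (min ((\<Sum>w\<in>N. L w) * p x)
      (c + (\<Sum>w\<in>N. min c (L w * (1 - p w)) - c)))" for p :: "'v \<Rightarrow> real"
  let ?D = "\<Sum>v\<in>N. Poly_Mapping.single (vertex_point v) (1::int)"
  let ?E = "\<Sum>v\<in>N. Poly_Mapping.single (edge_point G v x c) (1::int)"
  have fin: "finite {w. (y, w) \<in> arcs G}" for y
    by (rule finite_subset[of _ "verts G"]) (use finite_verts arcD in auto)
  have finN: "finite N"
    unfolding N_def by (rule finite_subset[of _ "verts G"]) (use finite_verts arcD in auto)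
  have N: "(v, x) \<in> arcs G" "(x, v) \<in> arcs G" "v \<noteq> x" "0 < L v" "c \<le> L v" "edge_len G {x, v} = L v"
    if "v \<in> N" for v
    using that arcD[of v x] arc_commute[of v x] cL[of v]
    by (auto simp: N_def L_def insert_commute)
  have nbr: "{w. (x, w) \<in> arcs G} = N"
    using arc_commute by (auto simp: N_def)
  have f_star: "f (edge_point G v x s) = min c s" if v: "v \<in> N" and s: "0 \<le> s" "s \<le> L v" for v s
  proof -
    let ?p = "edge_point G v x s"
    have px: "?p x = s / L v" and pv: "?p v = 1 - s / L v" and pw: "\<And>w. w \<noteq> v \<Longrightarrow> w \<noteq> x \<Longrightarrow> ?p w = 0"
      using N[OF v] by (auto simp: edge_point_def L_def)
    have "(\<Sum>w\<in>N. min c (L w * (1 - ?p w)) - c) = (\<Sum>w\<in>N. if w = v then min c s - c else 0)"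
    proof (rule sum.cong)
      fix w assume w: "w \<in> N"
      show "min c (L w * (1 - ?p w)) - c = (if w = v then min c s - c else 0)"
        using pv pw[of w] N(3,5)[OF w] N(4)[OF v] by (cases "w = v") simp_all
    qed simp
    then have "c + (\<Sum>w\<in>N. min c (L w * (1 - ?p w)) - c) = min c s"
      using v finN by simp
    moreover have "s \<le> (\<Sum>w\<in>N. L w) * ?p x"
    proof -
      have "L v \<le> (\<Sum>w\<in>N. L w)"
        using N(4) by (intro member_le_sum[OF v _ finN]) (auto simp: less_imp_le)
      then have "L v * (s / L v) \<le> (\<Sum>w\<in>N. L w) * (s / L v)"
        using s(1) N(4)[OF v] by (intro mult_right_mono) auto
      then show ?thesis
        using N(4)[OF v] by (simp add: px)
    qed
    ultimately show ?thesis
      using c s by (simp add: f_def)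
  qed
  have f_other: "f (edge_point G y z s) = 0" if "y \<noteq> x" "z \<noteq> x" for y z s
    using that by (simp add: f_def edge_point_def)
  have arc_cases: "y \<in> N \<and> z = x \<or> z \<in> N \<and> y = x \<or> y \<noteq> x \<and> z \<noteq> x" if "(y, z) \<in> arcs G" for y z
    using that arc_commute[of y z] by (auto simp: N_def)
  have zero: "piecewise_linear_int l (\<lambda>s. 0)" for l
    by (auto intro!: piecewise_linear_intI[of "{}"] exI[of _ "0::int"])
  have pl: "piecewise_linear_int (L v) (\<lambda>s. f (edge_point G v x s))" if v: "v \<in> N" for v
  proof (rule piecewise_linear_intI[of "{c}"])
    fix a b assume ab: "0 \<le> a" "a < b" "b \<le> L v" and "\<And>y. y \<in> {c} \<Longrightarrow> y \<le> a \<or> b \<le> y"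
    then consider "c \<le> a" | "b \<le> c" by auto
    then show "\<exists>m::int. \<forall>s. a \<le> s \<and> s \<le> b \<longrightarrow>
        f (edge_point G v x s) = f (edge_point G v x a) + of_int m * (s - a)"
    proof cases
      case 1
      with ab show ?thesis by (intro exI[of _ 0]) (auto simp: f_star[OF v])
    next
      case 2
      with ab show ?thesis by (intro exI[of _ 1]) (auto simp: f_star[OF v])
    qed
  qed simp
  have rat: "rational_function G f"
  proof (rule rational_functionI)
    show "continuous_on (points G) f"
      unfolding f_def by (intro continuous_intros continuous_on_coordinate)
    fix y z assume "(y, z) \<in> arcs G"
    then consider "y \<in> N" "z = x" | "z \<in> N" "y = x" | "y \<noteq> x" "z \<noteq> x"
      using arc_cases by blast
    then show "piecewise_linear_int (edge_len G {y, z}) (\<lambda>s. f (edge_point G y z s)) \<or>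
        piecewise_linear_int (edge_len G {y, z}) (\<lambda>s. f (edge_point G z y s))"
    proof cases
      case 1
      with pl[of y] show ?thesis by (simp add: L_def)
    next
      case 2
      with pl[of z] show ?thesis by (simp add: L_def insert_commute)
    next
      case 3
      with zero show ?thesis by (simp add: f_other)
    qed
  qed
  have slope_to: "slope G f v x t = (if t < c then 1 else 0)" if v: "v \<in> N" and t: "0 \<le> t" "t < L v" for v t
  proof (cases "t < c")
    case True
    have "slope G f v x t = 1"
      using order_refl True by (rule slope_affine) (use t N[OF v] in \<open>auto simp: f_star[OF v]\<close>)
    with True show ?thesis by simp
  next
    case False
    have "slope G f v x t = 0"
      using order_refl t(2) by (rule slope_affine) (use t False in \<open>auto simp: f_star[OF v]\<close>)
    with False show ?thesis by simp
  qed
  have slope_from: "slope G f x v (L v - t) = (if t \<le> c then -1 else 0)"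
    if v: "v \<in> N" and t: "0 < t" "t \<le> L v" for v t
  proof -
    note rev = slope_reverse_affine[OF N(1)[OF v], of _ t t, folded L_def, OF _ order_refl]
    show ?thesis
    proof (cases "t \<le> c")
      case True
      have "slope G f x v (L v - t) = - 1"
        using t(1) by (rule rev) (use t True in \<open>auto simp: f_star[OF v]\<close>)
      with True show ?thesis by simp
    next
      case False
      then have "c < t" by simp
      then have "slope G f x v (L v - t) = - 0"
        by (rule rev) (use t c in \<open>auto simp: f_star[OF v]\<close>)
      with False show ?thesis by simp
    qed
  qed
  have slope_other: "slope G f y z t = 0"
    if "(y, z) \<in> arcs G" "y \<noteq> x" "z \<noteq> x" "0 \<le> t" "t < edge_len G {y, z}" for y z t
    using that by (intro slope_eq_0) (simp_all add: f_other)
  have lookup: "Poly_Mapping.lookup (?D - ?E) p =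
      (\<Sum>v\<in>N. if vertex_point v = p then 1 else 0) - (\<Sum>v\<in>N. if edge_point G v x c = p then 1 else 0)" for p
    unfolding lookup_minus lookup_sum lookup_single when_def ..
  have at_c: "0 < edge_point G v x c x" if "v \<in> N" for v
    using N[OF that] c by (simp add: edge_point_def L_def)
  have vertex_c: "edge_point G v x c = vertex_point y \<longleftrightarrow> c = L v \<and> y = x" if v: "v \<in> N" for v y
  proof
    assume eq: "edge_point G v x c = vertex_point y"
    then have "y = x"
      using at_c[OF v] by (simp add: indicator_def split: if_splits)
    then have "edge_point G v x c = edge_point G v x (L v)"
      using eq edge_point_len[OF N(1)[OF v]] by (simp add: L_def)
    with \<open>y = x\<close> show "c = L v \<and> y = x"
      unfolding edge_point_eq_iff[OF N(1)[OF v]] by simp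
  next
    assume "c = L v \<and> y = x"
    with edge_point_len[OF N(1)[OF v]] show "edge_point G v x c = vertex_point y"
      by (simp add: L_def)
  qed
  have "is_div G f (?D - ?E)"
  proof (rule is_divI_one_orientation)
    have "p \<in> points G" if "Poly_Mapping.lookup (?D - ?E) p \<noteq> 0" for p
    proof -
      have "\<exists>v\<in>N. p = vertex_point v \<or> p = edge_point G v x c"
      proof (rule ccontr)
        assume "\<not> ?thesis"
        then have "\<And>v. v \<in> N \<Longrightarrow> vertex_point v \<noteq> p \<and> edge_point G v x c \<noteq> p"
          by blast
        then have "Poly_Mapping.lookup (?D - ?E) p = 0"
          unfolding lookup by simp
        with that show False by simp
      qed
      then obtain v where v: "v \<in> N" "p = vertex_point v \<or> p = edge_point G v x c"
        by blast
      then show ?thesis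
        using N[OF v(1)] c arcD(3)[OF N(1)[OF v(1)]]
        by (auto intro!: vertex_point_in_points edge_point_in_points simp: L_def)
    qed
    then show "divisor_on G (?D - ?E)"
      unfolding divisor_on_def by (intro subsetI) (simp only: in_keys_iff)
  next
    fix y assume y: "y \<in> verts G"
    consider "y = x" | "y \<in> N" | "y \<noteq> x" "y \<notin> N" by blast
    then show "of_int (Poly_Mapping.lookup (?D - ?E) (vertex_point y)) =
        (\<Sum>w | (y, w) \<in> arcs G. slope G f y w 0)"
    proof cases
      case 1
      have "x \<notin> N"
        using N(3) by blast
      then have "(\<Sum>v\<in>N. if vertex_point v = vertex_point y then 1 else 0) = (0::int)"
        using 1 by (intro sum.neutral) (auto simp: vertex_point_eq_iff)
      moreover have "(\<Sum>v\<in>N. if edge_point G v x c = vertex_point y then 1 else 0) =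
          (\<Sum>v\<in>N. if c = L v then 1 else (0::int))"
        using 1 by (intro sum.cong) (auto simp: vertex_c)
      moreover have "(\<Sum>w | (y, w) \<in> arcs G. slope G f y w 0) = (\<Sum>v\<in>N. - (if c = L v then 1 else 0))"
      proof (rule sum.cong)
        show "{w. (y, w) \<in> arcs G} = N"
          using 1 nbr by simp
        fix v assume v: "v \<in> N"
        with slope_from[of v "L v"] N[OF v] 1
        show "slope G f y v 0 = - (if c = L v then 1 else 0)" by auto
      qed
      moreover have "of_int (\<Sum>v\<in>N. if c = L v then 1 else (0::int)) =
          (\<Sum>v\<in>N. if c = L v then 1 else (0::real))"
        unfolding of_int_sum by (intro sum.cong) auto
      ultimately show ?thesis
        unfolding lookup by (simp add: sum_negf)
    next
      case 2
      have "y \<noteq> x"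
        using 2 N(3) by blast
      have "(\<Sum>v\<in>N. if vertex_point v = vertex_point y then 1 else 0) = (1::int)"
        unfolding vertex_point_eq_iff using 2 finN by simp
      moreover have "(\<Sum>v\<in>N. if edge_point G v x c = vertex_point y then 1 else 0) = (0::int)"
        using \<open>y \<noteq> x\<close> by (intro sum.neutral) (auto simp: vertex_c)
      moreover have "(\<Sum>w | (y, w) \<in> arcs G. slope G f y w 0) =
          (\<Sum>w | (y, w) \<in> arcs G. if w = x then slope G f y x 0 else 0)"
        using \<open>y \<noteq> x\<close> by (intro sum.cong) (auto simp: slope_other arcD)
      moreover have "\<dots> = 1"
        using fin[of y] N[OF 2] slope_to[OF 2, of 0] c by simp
      ultimately show ?thesis
        unfolding lookup by simp
    next
      case 3
      have "(\<Sum>v\<in>N. if vertex_point v = vertex_point y then 1 else 0) = (0::int)"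
        using 3 by (intro sum.neutral) (auto simp: vertex_point_eq_iff)
      moreover have "(\<Sum>v\<in>N. if edge_point G v x c = vertex_point y then 1 else 0) = (0::int)"
        using 3 by (intro sum.neutral) (auto simp: vertex_c)
      moreover have "(\<Sum>w | (y, w) \<in> arcs G. slope G f y w 0) = 0"
      proof (intro sum.neutral ballI)
        fix w assume "w \<in> {w. (y, w) \<in> arcs G}"
        then have yw: "(y, w) \<in> arcs G" by simp
        with 3 have "w \<noteq> x"
          by (auto simp: N_def)
        with 3 yw show "slope G f y w 0 = 0"
          by (simp add: slope_other arcD)
      qed
      ultimately show ?thesis
        unfolding lookup by simp
    qed
  next
    fix y z assume yz: "(y, z) \<in> arcs G"
    have star: "of_int (Poly_Mapping.lookup (?D - ?E) (edge_point G v x t)) =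
        slope G f v x t + slope G f x v (L v - t)" if v: "v \<in> N" and t: "0 < t" "t < L v" for v t
    proof -
      have "vertex_point w \<noteq> edge_point G v x t" for w
        using support_edge_point[OF N(1)[OF v] t[unfolded L_def]] support_vertex_point[of w] N(3)[OF v]
        by (metis doubleton_eq_iff insert_absorb2)
      then have "(\<Sum>w\<in>N. if vertex_point w = edge_point G v x t then 1 else 0) = (0::int)"
        by simp
      moreover have "edge_point G w x c = edge_point G v x t \<longleftrightarrow> w = v \<and> c = t" if w: "w \<in> N" for w
      proof
        assume eq: "edge_point G w x c = edge_point G v x t"
        have "edge_point G v x t v \<noteq> 0"
          using t N[OF v] by (simp add: edge_point_def L_def)
        then have "w = v"
          using N(3)[OF v] by (simp add: eq[symmetric]) (simp add: edge_point_def split: if_splits)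
        with eq edge_point_eq_iff[OF N(1)[OF v]] show "w = v \<and> c = t" by simp
      qed simp
      then have "(\<Sum>w\<in>N. if edge_point G w x c = edge_point G v x t then 1 else 0) =
          (\<Sum>w\<in>N. if w = v then if c = t then 1 else 0 else (0::int))"
        by (intro sum.cong) auto
      then have "(\<Sum>w\<in>N. if edge_point G w x c = edge_point G v x t then 1 else 0) =
          (if c = t then 1 else (0::int))"
        using v finN by simp
      ultimately show ?thesis
        unfolding lookup using slope_to[OF v, of t] slope_from[OF v, of t] t by simp
    qed
    from yz consider "y \<in> N" "z = x" | "z \<in> N" "y = x" | "y \<noteq> x" "z \<noteq> x"
      using arc_cases by blast
    then show "\<exists>a b. {a, b} = {y, z} \<and> (\<forall>t. 0 < t \<and> t < edge_len G {y, z} \<longrightarrow>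
        of_int (Poly_Mapping.lookup (?D - ?E) (edge_point G a b t)) =
        slope G f a b t + slope G f b a (edge_len G {y, z} - t))"
    proof cases
      case 1
      with star[of y] show ?thesis
        by (intro exI[of _ y] exI[of _ x]) (simp add: L_def)
    next
      case 2
      with star[of z] show ?thesis
        by (intro exI[of _ z] exI[of _ x]) (simp add: L_def insert_commute)
    next
      case 3
      have "of_int (Poly_Mapping.lookup (?D - ?E) (edge_point G y z t)) =
          slope G f y z t + slope G f z y (edge_len G {y, z} - t)"
        if t: "0 < t" "t < edge_len G {y, z}" for t
      proof -
        have "vertex_point w \<noteq> edge_point G y z t" for w
          using support_edge_point[OF yz t] support_vertex_point[of w] arcD(1)[OF yz]
          by (metis doubleton_eq_iff insert_absorb2)
        moreover have "edge_point G w x c \<noteq> edge_point G y z t" if "w \<in> N" for w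
        proof
          assume "edge_point G w x c = edge_point G y z t"
          moreover have "edge_point G y z t x = 0"
            using 3 by (simp add: edge_point_def)
          ultimately show False
            using at_c[OF that] by simp
        qed
        ultimately have "Poly_Mapping.lookup (?D - ?E) (edge_point G y z t) = 0"
          unfolding lookup by simp
        with 3 t yz arc_commute[of y z] show ?thesis
          by (simp add: slope_other insert_commute)
      qed
      then show ?thesis by blast
    qed
  qed
  with rat show ?thesis
    unfolding lin_equiv_def N_def by blast
qed

end

section \<open>A divisor of positive rank\<close>

context finite_metric_graph
begin

text \<open>The point \<open>p\<close> belongs to the support of an effective divisor equivalent to \<open>D\<close>.\<close>

definition reachable :: "'v divisor \<Rightarrow> ('v \<Rightarrow> real) \<Rightarrow> bool" where
  "reachable D p \<longleftrightarrow> (\<exists>E. divisor_on G E \<and> effective E \<and> lin_equiv G E D \<and> 0 < Poly_Mapping.lookup E p)"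

lemma reachable_lin_equiv: "reachable D p \<Longrightarrow> lin_equiv G D E \<Longrightarrow> reachable E p"
  unfolding reachable_def using lin_equiv_trans by blast

lemma reachable_refl:
  "divisor_on G D \<Longrightarrow> effective D \<Longrightarrow> 0 < Poly_Mapping.lookup D p \<Longrightarrow> reachable D p"
  unfolding reachable_def using lin_equiv_refl by blast

lemma rank_at_least_1I:
  assumes "\<And>p. p \<in> points G \<Longrightarrow> reachable D p"
  shows "rank_at_least G D 1"
  unfolding rank_at_least_def
proof (intro allI impI, elim conjE)
  fix E :: "'v divisor" assume E: "divisor_on G E" "effective E" "deg E = int 1"
  then obtain p where p: "E = Poly_Mapping.single p 1" "p \<in> Poly_Mapping.keys E"
    using effective_deg_1[of E] by auto
  with E(1) have "p \<in> points G"
    by (auto simp: divisor_on_def)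
  with assms obtain F where F: "divisor_on G F" "effective F" "lin_equiv G F D"
    "0 < Poly_Mapping.lookup F p"
    unfolding reachable_def by blast
  have "0 \<le> Poly_Mapping.lookup (F - E) q" for q
    using F(2,4) by (cases "p = q") (simp_all add: p(1) lookup_minus lookup_single effective_def)
  then have "effective (F - E)"
    by (simp add: effective_def)
  moreover have "divisor_on G (F - E)"
    using F(1) E(1) by (rule divisor_on_diff)
  moreover have "lin_equiv G (F - E) (D - E)"
    using F(3) unfolding lin_equiv_def by simp
  ultimately show "linear_system G (D - E) \<noteq> {}"
    unfolding linear_system_def by blast
qed

lemma reachable_between:
  assumes D: "divisor_on G D" "effective D" and uv: "(u, v) \<in> arcs G"
    and chips: "0 < Poly_Mapping.lookup D (edge_point G u v m)" "0 < Poly_Mapping.lookup D (vertex_point v)"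
    and t: "0 \<le> m" "m < t" "t < edge_len G {u, v}"
  shows "reachable D (edge_point G u v t)"
proof -
  \<comment> \<open>The chip that is closer to the target point moves there.\<close>
  define c where "c = min (t - m) (edge_len G {u, v} - t)"
  have c: "0 < c" "m + 2 * c \<le> edge_len G {u, v}"
    using t by (simp_all add: c_def min_def)
  let ?A = "Poly_Mapping.single (edge_point G u v m) (1::int) + Poly_Mapping.single (vertex_point v) 1"
  let ?B = "Poly_Mapping.single (edge_point G u v (m + c)) (1::int) +
      Poly_Mapping.single (edge_point G u v (edge_len G {u, v} - c)) 1"
  define E where "E = D - ?A + ?B"
  have ne: "edge_point G u v m \<noteq> vertex_point v"
    using t edge_point_eq_iff[OF uv, of m "edge_len G {u, v}"] by (simp add: edge_point_len[OF uv])
  have "0 \<le> Poly_Mapping.lookup (D - ?A) p" for p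
  proof -
    consider "p = edge_point G u v m" | "p = vertex_point v"
      | "p \<noteq> edge_point G u v m" "p \<noteq> vertex_point v" by blast
    then show ?thesis
      unfolding lookup_minus lookup_add lookup_single
      using chips ne D(2) by cases (simp_all add: effective_def when_def)
  qed
  then have "effective (D - ?A)"
    by (simp add: effective_def)
  moreover have "effective ?B"
    by (intro effective_add effective_single) simp_all
  ultimately have "effective E"
    unfolding E_def by (rule effective_add)
  moreover have "divisor_on G E"
    unfolding E_def using D(1) uv c t arcD[OF uv]
    by (intro divisor_on_diff divisor_on_add divisor_on_single vertex_point_in_points
        edge_point_in_points) simp_all
  moreover have "lin_equiv G E D"
  proof -
    have "E - D = ?B - ?A"
      by (simp add: E_def)
    with lin_equiv_sym[OF lin_equiv_move_pair[OF uv t(1) c]] show ?thesis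
      unfolding lin_equiv_def by simp
  qed
  moreover have "0 < Poly_Mapping.lookup E (edge_point G u v t)"
  proof -
    have "t = m + c \<or> t = edge_len G {u, v} - c"
      by (auto simp: c_def)
    then have "0 < Poly_Mapping.lookup ?B (edge_point G u v t)"
      unfolding lookup_add lookup_single edge_point_eq_iff[OF uv] by (auto simp: when_def)
    with \<open>effective (D - ?A)\<close> show ?thesis
      unfolding E_def lookup_add[of "D - ?A"] effective_def by (simp add: add_nonneg_pos)
  qed
  ultimately show ?thesis
    unfolding reachable_def by blast
qed

text \<open>
  With one chip on each neighbour of \<open>x\<close>, moving the chips towards \<open>x\<close> until the first one
  arrives there reaches the far part of every edge at \<open>x\<close>; the rest of such an edge lies
  between its own chip and the one that has arrived at \<open>x\<close>.
\<close>

lemma reachable_star: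
  assumes ux: "(u, x) \<in> arcs G" and t: "0 < t" "t \<le> edge_len G {u, x}"
  shows "reachable (\<Sum>v | (v, x) \<in> arcs G. Poly_Mapping.single (vertex_point v) 1) (edge_point G u x t)"
proof -
  define N where "N = {v. (v, x) \<in> arcs G}"
  define m where "m = Min ((\<lambda>v. edge_len G {v, x}) ` N)"
  define E where "E c = (\<Sum>v\<in>N. Poly_Mapping.single (edge_point G v x c) (1::int))" for c
  have fin: "finite N"
    unfolding N_def by (rule finite_subset[of _ "verts G"]) (use finite_verts arcD in auto)
  have u: "u \<in> N"
    using ux by (simp add: N_def)
  have m_le: "m \<le> edge_len G {v, x}" if "v \<in> N" for v
    using fin that by (simp add: m_def)
  obtain w where w: "w \<in> N" "m = edge_len G {w, x}"
    using Min_in[of "(\<lambda>v. edge_len G {v, x}) ` N"] fin u unfolding m_def by blast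
  have m_pos: "0 < m"
    using w arcD(5)[of w x] by (simp add: N_def)
  have lookup_E: "Poly_Mapping.lookup (E c) p = (\<Sum>v\<in>N. if edge_point G v x c = p then 1 else 0)" for c p
    unfolding E_def lookup_sum lookup_single when_def ..
  have eff: "effective (E c)" for c
    unfolding effective_def lookup_E by (auto intro: sum_nonneg)
  have chip: "0 < Poly_Mapping.lookup (E c) (edge_point G v x c)" if "v \<in> N" for v c
    unfolding lookup_E using fin that by (intro sum_pos2[of _ v]) auto
  have div: "divisor_on G (E c)" if "0 < c" "c \<le> m" for c
    unfolding divisor_on_def
  proof
    fix p assume "p \<in> Poly_Mapping.keys (E c)"
    then have "(\<Sum>v\<in>N. if edge_point G v x c = p then 1 else 0) \<noteq> (0::int)"
      unfolding in_keys_iff lookup_E .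
    then obtain v where "v \<in> N" "(if edge_point G v x c = p then 1 else 0) \<noteq> (0::int)"
      by (rule sum.not_neutral_contains_not_neutral)
    then have "v \<in> N" "edge_point G v x c = p"
      by (auto split: if_splits)
    with that m_le[of v] show "p \<in> points G"
      by (auto intro!: edge_point_in_points simp: N_def)
  qed
  have equiv: "lin_equiv G (E c) (\<Sum>v\<in>N. Poly_Mapping.single (vertex_point v) 1)"
    if "0 < c" "c \<le> m" for c
    using that m_le unfolding E_def N_def
    by (intro lin_equiv_sym[OF lin_equiv_fire_towards]) (force simp: N_def)+
  have "\<exists>c. 0 < c \<and> c \<le> m \<and> reachable (E c) (edge_point G u x t)"
  proof (cases "t \<le> m")
    case True
    with t chip[OF u] div eff show ?thesis
      by (intro exI[of _ t]) (auto intro: reachable_refl)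
  next
    case False
    have x: "0 < Poly_Mapping.lookup (E m) (vertex_point x)"
      using chip[OF w(1), of m] w edge_point_len[of w x] by (simp add: N_def)
    have "reachable (E m) (edge_point G u x t)"
    proof (cases "t = edge_len G {u, x}")
      case True
      with x div[OF m_pos] eff show ?thesis
        by (auto intro: reachable_refl simp: edge_point_len[OF ux])
    next
      case neq: False
      show ?thesis
        by (rule reachable_between[OF div[OF m_pos order_refl] eff ux chip[OF u] x])
          (use False neq t m_pos in auto)
    qed
    with m_pos show ?thesis by blast
  qed
  then show ?thesis
    using equiv reachable_lin_equiv unfolding N_def by blast
qed

text \<open>
  If \<open>C\<close> is a vertex cover all of whose vertices are adjacent to every vertex outside \<open>C\<close>, then
  the sum of the vertices in \<open>C\<close> has positive rank.
\<close>

lemma rank_at_least_1_vertex_cover: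
  assumes C: "C \<subseteq> verts G" "C \<noteq> {}"
    and cover: "\<And>u v. (u, v) \<in> arcs G \<Longrightarrow> u \<in> C \<or> v \<in> C"
    and complete: "\<And>x. x \<in> verts G - C \<Longrightarrow> {v. (v, x) \<in> arcs G} = C"
  shows "rank_at_least G (\<Sum>v\<in>C. Poly_Mapping.single (vertex_point v) 1) 1"
proof (rule rank_at_least_1I)
  let ?D = "\<Sum>v\<in>C. Poly_Mapping.single (vertex_point v) (1::int)"
  have fin: "finite C"
    using C(1) finite_verts by (rule finite_subset)
  have lookup: "Poly_Mapping.lookup ?D p = (\<Sum>v\<in>C. if vertex_point v = p then 1 else 0)" for p
    unfolding lookup_sum lookup_single when_def ..
  have eff: "effective ?D"
    unfolding effective_def lookup by (auto intro: sum_nonneg)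
  have div: "divisor_on G ?D"
    unfolding divisor_on_def
  proof
    fix p assume "p \<in> Poly_Mapping.keys ?D"
    then have "(\<Sum>v\<in>C. if vertex_point v = p then 1 else 0) \<noteq> (0::int)"
      unfolding in_keys_iff lookup .
    then obtain v where "v \<in> C" "(if vertex_point v = p then 1 else 0) \<noteq> (0::int)"
      by (rule sum.not_neutral_contains_not_neutral)
    then have "v \<in> C" "vertex_point v = p"
      by (auto split: if_splits)
    with C(1) show "p \<in> points G"
      using vertex_point_in_points by auto
  qed
  have chip: "0 < Poly_Mapping.lookup ?D (vertex_point v)" if "v \<in> C" for v
    unfolding lookup using fin that by (intro sum_pos2[of _ v]) auto
  have to_x: "reachable ?D (edge_point G u x t)"
    if "u \<in> C" "x \<in> verts G - C" "0 < t" "t \<le> edge_len G {u, x}" for u x t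
    using reachable_star[of u x t] complete[OF that(2)] that by auto
  fix p assume "p \<in> points G"
  then show "reachable ?D p"
  proof (cases rule: points_cases)
    case (vertex x)
    show ?thesis
    proof (cases "x \<in> C")
      case True
      with vertex div eff chip show ?thesis by (auto intro: reachable_refl)
    next
      case False
      obtain u where "u \<in> C"
        using C(2) by blast
      moreover have "(u, x) \<in> arcs G"
        using complete[of x] False vertex \<open>u \<in> C\<close> by auto
      ultimately show ?thesis
        using to_x[of u x "edge_len G {u, x}"] False vertex arcD(5)[of u x] edge_point_len[of u x]
        by simp
    qed
  next
    case (interior u v t)
    have rev: "p = edge_point G v u (edge_len G {v, u} - t)" "edge_len G {v, u} = edge_len G {u, v}"
      using interior edge_point_reverse[OF interior(1)] by (simp_all add: insert_commute)
    note uv = arcD[OF interior(1)]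
    from cover[OF interior(1)] consider "u \<in> C" "v \<in> C" | "u \<in> C" "v \<notin> C" | "u \<notin> C" "v \<in> C"
      by blast
    then show ?thesis
    proof cases
      case 1
      with interior chip edge_point_0[OF interior(1)] show ?thesis
        by (simp only: interior(4)) (rule reachable_between[OF div eff interior(1), of 0]; simp)
    next
      case 2
      with interior uv to_x[of u v t] show ?thesis by simp
    next
      case 3
      with interior uv rev to_x[of v u "edge_len G {v, u} - t"] show ?thesis by simp
    qed
  qed
qed

lemma deg_sum_vertex_points:
  assumes "finite C"
  shows "deg (\<Sum>v\<in>C. Poly_Mapping.single (vertex_point v) 1) = int (card C)"
  using assms
proof (induction C)
  case empty
  show ?case by (simp add: deg_def)
next
  case (insert v C)
  then show ?case
    unfolding sum.insert[OF insert.hyps] deg_add deg_single by simp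
qed

lemma divisor_on_sum_vertex_points:
  assumes "C \<subseteq> verts G"
  shows "divisor_on G (\<Sum>v\<in>C. Poly_Mapping.single (vertex_point v) 1)"
  using finite_subset[OF assms finite_verts] assms
proof (induction C)
  case empty
  show ?case by (simp add: divisor_on_def)
next
  case (insert v C)
  then show ?case
    unfolding sum.insert[OF insert.hyps]
    by (intro divisor_on_add divisor_on_single vertex_point_in_points) auto
qed

end

section \<open>The complete graph without the edges inside \<open>H\<close>\<close>

text \<open>
  If \<open>C = V - H\<close> lies on one side of the cut, then the edges from any vertex on the other side to \<open>C\<close>
  are in the cut. Otherwise there are \<open>a, b \<in> C\<close> on different sides, and all other vertices
  send an edge across the cut to \<open>a\<close> or to \<open>b\<close>; together with \<open>{a, b}\<close> these are \<open>card V - 1\<close> edges.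
\<close>

lemma edge_cut_complete_minus_complete:
  fixes V H :: "'v set" and l :: "'v set \<Rightarrow> real"
  assumes V: "finite V" and H: "H \<subseteq> V" "H \<noteq> {}" and A: "A \<subseteq> V" "A \<noteq> {}" "A \<noteq> V"
  shows "card V - card H \<le> card (edge_cut (omit_edges_within (complete_graph V l) H) A)"
proof -
  let ?cut = "edge_cut (omit_edges_within (complete_graph V l) H) A"
  define C where "C = V - H"
  have cardC: "card C = card V - card H"
    using V H by (simp add: C_def card_Diff_subset finite_subset)
  have mem: "{a, b} \<in> ?cut" if "a \<in> A" "b \<in> V - A" "a \<in> C \<or> b \<in> C" for a b
  proof -
    have "a \<noteq> b"
      using that by auto
    then show ?thesis
      using that A by (auto simp: edge_cut_def omit_edges_within_def complete_graph_def C_def)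
  qed
  have fin: "finite ?cut"
    by (rule finite_subset[of _ "Pow V"])
      (use V in \<open>auto simp: edge_cut_def omit_edges_within_def complete_graph_def\<close>)
  have star: "card C \<le> card ?cut" if "\<And>w. w \<in> C \<Longrightarrow> {x, w} \<in> ?cut" "x \<notin> C" for x
  proof (rule card_inj_on_le[of "\<lambda>w. {x, w}"])
    show "inj_on (\<lambda>w. {x, w}) C"
      by (auto simp: inj_on_def doubleton_eq_iff)
  qed (use that fin in auto)
  consider "C \<subseteq> A" | "C \<inter> A = {}" | a b where "a \<in> C" "a \<in> A" "b \<in> C" "b \<notin> A"
    by blast
  then show ?thesis
  proof cases
    case 1
    obtain x where "x \<in> V - A"
      using A by blast
    with 1 mem star[of x] show ?thesis
      unfolding cardC[symmetric] by (auto simp: insert_commute)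
  next
    case 2
    obtain x where "x \<in> A"
      using A by blast
    with 2 mem[of x] star[of x] show ?thesis
      unfolding cardC[symmetric] by (auto simp: C_def)
  next
    case (3 a b)
    let ?X = "(\<lambda>y. {a, y}) ` (V - A)" and ?Y = "(\<lambda>x. {x, b}) ` (A - {a})"
    have b: "b \<in> V - A"
      using 3 by (simp add: C_def)
    have finA: "finite A" "finite (V - A)"
      using V A(1) finite_subset by auto
    have "card V = card (V - A) + card A"
      using V A(1) finA by (simp add: card_Diff_subset card_mono)
    also have "card A = Suc (card (A - {a}))"
      by (rule card.remove) (use 3 finA in auto)
    finally have cardV: "card V = Suc (card (V - A) + card (A - {a}))"
      by simp
    have "card H \<noteq> 0"
      using H V finite_subset[of H V] by simp
    then have "card V - card H \<le> card (V - A) + card (A - {a})"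
      unfolding cardV by simp
    also have "\<dots> = card ?X + card ?Y"
      by (subst (1 2) card_image) (auto simp: inj_on_def doubleton_eq_iff)
    also have "\<dots> = card (?X \<union> ?Y)"
      using 3 finA by (intro card_Un_disjoint[symmetric]) (auto simp: doubleton_eq_iff)
    also have "\<dots> \<le> card ?cut"
      using 3 b mem by (intro card_mono[OF fin]) auto
    finally show ?thesis .
  qed
qed

theorem theorem17:
  fixes V H :: "'v set" and l :: "'v set \<Rightarrow> real" and d h :: nat
  assumes "d \<ge> 3" and "1 \<le> h" and "h < d"
    and "finite V" and "card V = d"
    and "H \<subseteq> V" and "card H = h"
    and "\<forall>e \<in> edges (complete_graph V l). l e > 0"
  shows "gonality (omit_edges_within (complete_graph V l) H) = int d - int h"
proof -
  let ?G = "omit_edges_within (complete_graph V l) H"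
  have G: "verts ?G = V" "edges ?G = {e. e \<subseteq> V \<and> card e = 2 \<and> \<not> e \<subseteq> H}" "edge_len ?G = l"
    by (auto simp: omit_edges_within_def complete_graph_def)
  have "0 < l e" if "e \<subseteq> V" "card e = 2" for e
    using assms(8) that by (simp add: complete_graph_def)
  then interpret finite_metric_graph ?G
    using assms(4) by unfold_locales (auto simp: G)
  have arcs: "(u, v) \<in> arcs ?G \<longleftrightarrow> u \<noteq> v \<and> u \<in> V \<and> v \<in> V \<and> (u \<notin> H \<or> v \<notin> H)" for u v
    unfolding arcs_def by (auto simp: G)
  have H: "finite H" "H \<noteq> {}" and V: "V \<noteq> {}"
    using assms finite_subset by auto
  have cardC: "card (V - H) = d - h"
    using assms H(1) by (simp add: card_Diff_subset)
  then have C: "V - H \<noteq> {}"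
    using assms(3) by (metis card.empty zero_less_diff less_irrefl)
  have "gonality ?G = int (d - h)"
  proof (rule gonality_eqI)
    fix D :: "'v divisor" assume D: "divisor_on ?G D" "rank_at_least ?G D 1"
    show "int (d - h) \<le> deg D"
      by (rule rank_at_least_1_imp_deg_ge[OF D])
        (use edge_cut_complete_minus_complete[OF assms(4,6) H(2), of _ l] assms V in \<open>simp_all add: G\<close>)
  next
    show "rank_at_least ?G (\<Sum>v\<in>V - H. Poly_Mapping.single (vertex_point v) 1) 1"
      by (rule rank_at_least_1_vertex_cover) (use C assms(6) in \<open>auto simp: G arcs\<close>)
    show "divisor_on ?G (\<Sum>v\<in>V - H. Poly_Mapping.single (vertex_point v) 1)"
      by (rule divisor_on_sum_vertex_points) (auto simp: G)
    show "deg (\<Sum>v\<in>V - H. Poly_Mapping.single (vertex_point v) 1) = int (d - h)"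
      using assms(4) by (simp add: deg_sum_vertex_points cardC)
  qed (simp add: G V)
  with assms(3) show ?thesis
    by simp
qed

end
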